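(* Let $\alpha>1$ and let $X$ be a positive self-similar Markov process with self-similarity index $\alpha$, considered up to its first hitting time of $0$. Let $\theta$ be the right-continuous inverse of the clock $A_t=\int_0^t \frac{ds}{X_s}$, i.e. $\theta(t)=\inf\{s\ge 0: A_s>t\}$. Then the time-changed process $X_\theta=(X_{\theta(t)})_{t\ge 0}$ is a positive self-similar Markov process with self-similarity index $\alpha-1$, and the Lévy process underlying $X_\theta$ in its pssMp-Lamperti representation is the same as the Lévy process underlying $X$.
   Context: A positive self-similar Markov process (pssMp) with index $\alpha>0$ is a positive (strong) Markov process with càdlàg paths with laws $(\mathbb{Q}_x)_{x>0}$ ($\mathbb{Q}_x$ = law started from $x$) such that for all $k>0$ the law of $(kX_{k^{-\alpha}t},t\ge 0)$ under $\mathbb{Q}_x$ is $\mathbb{Q}_{kx}$. pssMp-Lamperti representation: for a pssMp of index $\alpha$ there is a Lévy process $\eta$ started from $0$ (possibly killed at an independent exponential time), whose law does not depend on $x$, called the underlying Lévy process, such that under $\mathbb{Q}_x$, up to the first hitting time of $0$, $$X_t=x\exp\{\eta_{\zeta(tx^{-\alpha})}\},\qquad 0\le t< x^{\alpha}\int_0^{\infty}e^{\alpha\eta_u}\,du,\qquad \zeta(t)=\inf\Big\{s\ge 0:\int_0^s e^{\alpha\eta_u}\,du>t\Big\}$$ (with the integral taken up to the killing time if $\eta$ is killed). *)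

theory Defs
  imports "HOL-Probability.Probability"
begin

text \<open>Processes are functions of type \<open>real \<Rightarrow> 'w \<Rightarrow> 'a\<close> of which only the values at times
  \<open>t \<ge> 0\<close> matter. Path space is the product space over \<open>{0..}\<close>.\<close>

abbreviation path_space :: "(real \<Rightarrow> 'a::topological_space) measure" where
  "path_space \<equiv> PiM {0..} (\<lambda>_. borel)"

definition sample_path :: "(real \<Rightarrow> 'w \<Rightarrow> 'a) \<Rightarrow> 'w \<Rightarrow> real \<Rightarrow> 'a" where
  "sample_path X \<omega> = (\<lambda>t\<in>{0..}. X t \<omega>)"

definition process_law :: "'w measure \<Rightarrow> (real \<Rightarrow> 'w \<Rightarrow> 'a::topological_space) \<Rightarrow> (real \<Rightarrow> 'a) measure" where
  "process_law M X = distr M path_space (sample_path X)"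

definition right_cont_path :: "(real \<Rightarrow> real) \<Rightarrow> bool" where
  "right_cont_path f \<longleftrightarrow> (\<forall>t\<ge>0. continuous (at_right t) f)"

definition left_limits_path :: "(real \<Rightarrow> real) \<Rightarrow> bool" where
  "left_limits_path f \<longleftrightarrow> (\<forall>t>0. \<exists>l. (f \<longlongrightarrow> l) (at_left t))"

definition cadlag_path :: "(real \<Rightarrow> real) \<Rightarrow> bool" where
  "cadlag_path f \<longleftrightarrow> right_cont_path f \<and> left_limits_path f"

text \<open>The natural filtration and its right limits \<open>F(t+) = \<Inter>\<epsilon>>0. F(t+\<epsilon>)\<close>. Time is \<open>[0,\<infinity>]\<close>, so
  that random times may be infinite; at \<open>t = \<infinity>\<close> both give the sigma-algebra of the whole process.\<close>

definition natural_filtration :: "'w measure \<Rightarrow> (real \<Rightarrow> 'w \<Rightarrow> real) \<Rightarrow> ennreal \<Rightarrow> 'w measure" where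
  "natural_filtration M X t =
     vimage_algebra (space M) (\<lambda>\<omega>. \<lambda>s\<in>{s. 0 \<le> s \<and> ennreal s \<le> t}. X s \<omega>)
       (PiM {s. 0 \<le> s \<and> ennreal s \<le> t} (\<lambda>_. borel))"

definition natural_filtration_right :: "'w measure \<Rightarrow> (real \<Rightarrow> 'w \<Rightarrow> real) \<Rightarrow> ennreal \<Rightarrow> 'w measure" where
  "natural_filtration_right M X t =
     sigma (space M) (\<Inter>\<epsilon>\<in>{0<..}. sets (natural_filtration M X (t + \<epsilon>)))"

text \<open>A positive self-similar Markov process up to its first hitting time of \<open>0\<close>: a family of
  laws \<open>Q x\<close>, \<open>x > 0\<close>, on one measurable space \<open>M\<close> (only its sigma-algebra is used),
  and a process \<open>X\<close> that is frozen at \<open>0\<close> from its first hitting time of \<open>0\<close> on; that is, \<open>0\<close> is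
  the cemetery.

  Right-continuity is required of every path and left limits of almost every path. The time change
  below preserves right-continuity path by path, but left limits only almost surely: they can fail
  on the null event that the time-changed process leaves the state space in finite time without
  \<open>X\<close> hitting \<open>0\<close>.

  \<open>law_measurable\<close> says that the family is a kernel. In \<open>strong_markov\<close> nothing needs to be
  said on the event \<open>X (T) = 0\<close>, where \<open>absorbed\<close> determines the future.\<close>

locale pssMp =
  fixes \<alpha> :: real
    and M :: "'w measure"
    and Q :: "real \<Rightarrow> 'w measure"
    and X :: "real \<Rightarrow> 'w \<Rightarrow> real"
  assumes index_pos: "\<alpha> > 0"
    and prob_space_Q: "x > 0 \<Longrightarrow> prob_space (Q x)"
    and sets_Q: "x > 0 \<Longrightarrow> sets (Q x) = sets M"
    and measurable_X: "t \<ge> 0 \<Longrightarrow> X t \<in> borel_measurable M"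
    and nonneg: "t \<ge> 0 \<Longrightarrow> \<omega> \<in> space M \<Longrightarrow> X t \<omega> \<ge> 0"
    and absorbed: "0 \<le> s \<Longrightarrow> s \<le> t \<Longrightarrow> \<omega> \<in> space M \<Longrightarrow> X s \<omega> = 0 \<Longrightarrow> X t \<omega> = 0"
    and right_cont: "\<omega> \<in> space M \<Longrightarrow> right_cont_path (\<lambda>t. X t \<omega>)"
    and left_limits: "x > 0 \<Longrightarrow> AE \<omega> in Q x. left_limits_path (\<lambda>t. X t \<omega>)"
    and initial: "x > 0 \<Longrightarrow> AE \<omega> in Q x. X 0 \<omega> = x"
    and law_measurable: "C \<in> sets path_space \<Longrightarrow>
      (\<lambda>x. emeasure (Q x) {\<omega>\<in>space M. sample_path X \<omega> \<in> C}) \<in> borel_measurable (restrict_space borel {0<..})"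
    and strong_markov:
      "x > 0 \<Longrightarrow> stopping_time (natural_filtration_right M X) T \<Longrightarrow>
       B \<in> sets (filtration.pre_sigma (space M) (natural_filtration_right M X) T) \<Longrightarrow>
       C \<in> sets path_space \<Longrightarrow>
       emeasure (Q x) {\<omega>\<in>B. T \<omega> < \<infinity> \<and> X (enn2real (T \<omega>)) \<omega> > 0 \<and>
                            sample_path (\<lambda>u. X (enn2real (T \<omega>) + u)) \<omega> \<in> C} =
       (\<integral>\<^sup>+\<omega>\<in>{\<omega>\<in>B. T \<omega> < \<infinity> \<and> X (enn2real (T \<omega>)) \<omega> > 0}.
          emeasure (Q (X (enn2real (T \<omega>)) \<omega>)) {\<omega>'\<in>space M. sample_path X \<omega>' \<in> C} \<partial>Q x)"
    and self_similar:
      "x > 0 \<Longrightarrow> k > 0 \<Longrightarrow>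
       process_law (Q x) (\<lambda>t \<omega>. k * X (k powr (-\<alpha>) * t) \<omega>) = process_law (Q (k * x)) X"

definition levy_process :: "'b measure \<Rightarrow> (real \<Rightarrow> 'b \<Rightarrow> real) \<Rightarrow> bool" where
  "levy_process N \<xi> \<longleftrightarrow>
     prob_space N \<and>
     (\<forall>t\<ge>0. \<xi> t \<in> borel_measurable N) \<and>
     (AE \<omega> in N. \<xi> 0 \<omega> = 0) \<and>
     (AE \<omega> in N. cadlag_path (\<lambda>t. \<xi> t \<omega>)) \<and>
     (\<forall>(n::nat) t. 0 \<le> t 0 \<and> mono t \<longrightarrow>
        prob_space.indep_vars N (\<lambda>_. borel) (\<lambda>i \<omega>. \<xi> (t (Suc i)) \<omega> - \<xi> (t i) \<omega>) {..<n}) \<and>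
     (\<forall>s\<ge>0. \<forall>t\<ge>0. distr N borel (\<lambda>\<omega>. \<xi> (s + t) \<omega> - \<xi> s \<omega>) = distr N borel (\<xi> t))"

definition killing_time_law :: "real \<Rightarrow> ereal measure" where
  "killing_time_law q =
     (if q = 0 then return borel \<infinity> else distr (density lborel (exponential_density q)) borel ereal)"

text \<open>The cemetery of a killed process is \<open>-\<infinity>\<close>.\<close>

definition kill_at :: "(real \<Rightarrow> real) \<Rightarrow> ereal \<Rightarrow> real \<Rightarrow> ereal" where
  "kill_at f e t = (if ereal t < e then ereal (f t) else -\<infinity>)"

text \<open>A process on \<open>M\<close> with killed cadlag paths that has the law of a Levy process killed at an
  independent time with law \<open>killing_time_law q\<close>. The unkilled Levy process need not live on \<open>M\<close>; it
  is the coordinate process under a measure \<open>N\<close> on paths, which is no loss of generality, and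
  independence of the killing time is expressed by the product measure.\<close>

definition killed_levy_process :: "'w measure \<Rightarrow> (real \<Rightarrow> 'w \<Rightarrow> ereal) \<Rightarrow> bool" where
  "killed_levy_process M \<eta> \<longleftrightarrow>
     prob_space M \<and>
     (\<forall>t\<ge>0. \<eta> t \<in> borel_measurable M) \<and>
     (AE \<omega> in M. \<exists>f e. cadlag_path f \<and> e > 0 \<and> (\<forall>t\<ge>0. \<eta> t \<omega> = kill_at f e t)) \<and>
     (\<exists>(N :: (real \<Rightarrow> real) measure) q. q \<ge> 0 \<and> levy_process N (\<lambda>t f. f t) \<and>
        process_law M \<eta> =
        process_law (N \<Otimes>\<^sub>M killing_time_law q) (\<lambda>t (f, e). kill_at f e t))"

definition exp_killed :: "ereal \<Rightarrow> real" where
  "exp_killed y = (if y = -\<infinity> then 0 else exp (real_of_ereal y))"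

text \<open>Since \<open>exp_killed (-\<infinity>) = 0\<close>, the integrals below extend only up to the killing time.\<close>

definition exp_clock :: "real \<Rightarrow> (real \<Rightarrow> ereal) \<Rightarrow> real \<Rightarrow> ennreal" where
  "exp_clock \<alpha> h s = (\<integral>\<^sup>+u\<in>{0..s}. ennreal (exp_killed (ereal \<alpha> * h u)) \<partial>lborel)"

definition exp_clock_total :: "real \<Rightarrow> (real \<Rightarrow> ereal) \<Rightarrow> ennreal" where
  "exp_clock_total \<alpha> h = (\<integral>\<^sup>+u\<in>{0..}. ennreal (exp_killed (ereal \<alpha> * h u)) \<partial>lborel)"

text \<open>Used only for \<open>t < exp_clock_total \<alpha> h\<close>, where the infimum is over a nonempty set.\<close>

definition exp_clock_inverse :: "real \<Rightarrow> (real \<Rightarrow> ereal) \<Rightarrow> real \<Rightarrow> real" where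
  "exp_clock_inverse \<alpha> h t = Inf {s. 0 \<le> s \<and> exp_clock \<alpha> h s > ennreal t}"

definition lamperti_transform :: "real \<Rightarrow> real \<Rightarrow> (real \<Rightarrow> ereal) \<Rightarrow> real \<Rightarrow> real" where
  "lamperti_transform \<alpha> x h t =
     (if ennreal t < ennreal (x powr \<alpha>) * exp_clock_total \<alpha> h
      then x * exp_killed (h (exp_clock_inverse \<alpha> h (t * x powr (-\<alpha>))))
      else 0)"

definition underlying_levy_process ::
    "real \<Rightarrow> (real \<Rightarrow> 'w measure) \<Rightarrow> (real \<Rightarrow> 'w \<Rightarrow> real) \<Rightarrow> (real \<Rightarrow> 'w \<Rightarrow> ereal) \<Rightarrow> bool" where
  "underlying_levy_process \<alpha> Q X \<eta> \<longleftrightarrow>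
     (\<forall>x>0. killed_levy_process (Q x) \<eta>) \<and>
     (\<forall>x>0. \<forall>y>0. process_law (Q x) \<eta> = process_law (Q y) \<eta>) \<and>
     (\<forall>x>0. AE \<omega> in Q x. \<forall>t\<ge>0. X t \<omega> = lamperti_transform \<alpha> x (\<lambda>u. \<eta> u \<omega>) t)"

text \<open>As \<open>inverse 0 = \<infinity>\<close> in \<^typ>\<open>ennreal\<close>, the clock is infinite after the hitting time \<open>T\<close> of \<open>0\<close>, so
  that \<open>\<theta>(t) = T\<close> if \<open>t \<ge> A(T)\<close> and \<open>T < \<infinity>\<close>.\<close>

definition clock :: "(real \<Rightarrow> 'w \<Rightarrow> real) \<Rightarrow> real \<Rightarrow> 'w \<Rightarrow> ennreal" where
  "clock X t \<omega> = (\<integral>\<^sup>+s\<in>{0..t}. inverse (ennreal (X s \<omega>)) \<partial>lborel)"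

definition clock_inverse :: "(real \<Rightarrow> 'w \<Rightarrow> real) \<Rightarrow> real \<Rightarrow> 'w \<Rightarrow> ennreal" where
  "clock_inverse X t \<omega> = (INF s\<in>{s. 0 \<le> s \<and> clock X s \<omega> > ennreal t}. ennreal s)"

definition time_changed :: "(real \<Rightarrow> 'w \<Rightarrow> real) \<Rightarrow> real \<Rightarrow> 'w \<Rightarrow> real" where
  "time_changed X t \<omega> =
     (if clock_inverse X t \<omega> = \<infinity> then 0 else X (enn2real (clock_inverse X t \<omega>)) \<omega>)"

end

theory Submission
  imports Defs
begin

text \<open>Every clause is transferred along the clock \<open>A(t) = \<integral>\<^sub>0\<^sup>t ds / X(s)\<close>. If \<open>\<theta>(T) = S < \<infinity>\<close> and
  \<open>X(S) > 0\<close>, then \<open>A(S) = T\<close>, so \<open>X\<^sub>\<theta>\<close> restarted at \<open>T\<close> is the time change of \<open>X\<close> restarted at \<open>S\<close>;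
  moreover \<open>\<theta>(T)\<close> is a stopping time for \<open>X\<close> whenever \<open>T\<close> is one for \<open>X\<^sub>\<theta>\<close>, since
  \<open>\<theta>(T) < r\<close> means \<open>T < A(q)\<close> for some rational \<open>q < r\<close>, and up to time \<open>A(q)\<close> the process \<open>X\<^sub>\<theta>\<close> depends
  only on \<open>X\<close> up to \<open>q\<close>. The index drops by one because \<open>k X(k\<^sup>-\<^sup>\<alpha> t)\<close> has clock \<open>k\<^sup>\<alpha>\<^sup>-\<^sup>1 A(k\<^sup>-\<^sup>\<alpha> t)\<close>.

  Left limits of \<open>X\<^sub>\<theta>\<close> could only fail if \<open>A(\<infinity>) < \<infinity>\<close>, which has probability zero: on that event the
  tail of the clock tends to \<open>0\<close>, while given \<open>X(t)\<close> it is distributed like \<open>X(t)\<^sup>\<alpha>\<^sup>-\<^sup>1 A(\<infinity>)\<close> under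
  \<open>Q 1\<close>; as \<open>\<alpha> > 1\<close>, this would make \<open>X(t) < K\<close> with probability tending to one, whereas a finite
  \<open>A(\<infinity>)\<close> lets \<open>X\<close> spend only finite time below \<open>K\<close>.

  For the Levy process, the substitution \<open>r = x\<^sup>\<alpha> \<integral>\<^sub>0\<^sup>s exp (\<alpha> \<eta>(u)) du\<close> turns \<open>dr / X(r)\<close> into
  \<open>x\<^sup>\<alpha>\<^sup>-\<^sup>1 exp ((\<alpha> - 1) \<eta>(s)) ds\<close>, so that the two time changes compose to the Lamperti time change of
  index \<open>\<alpha> - 1\<close>.\<close>

section \<open>Right-continuous processes and their clocks\<close>

lemma right_cont_path_tendsto:
  assumes "right_cont_path f" "0 \<le> t" shows "(f \<longlongrightarrow> f t) (at_right t)"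
  using assms by (auto simp: right_cont_path_def continuous_within)

text \<open>The grid point of mesh 1/(n+1) strictly to the right of \<open>u\<close>. Strictness
  matters because right-continuity says nothing about approach from the left.\<close>

lemma grid_above_bounds:
  fixes u :: real
  assumes "0 \<le> u"
  shows "u < (real (nat \<lfloor>real (Suc n) * u\<rfloor>) + 1) / real (Suc n)"
    "(real (nat \<lfloor>real (Suc n) * u\<rfloor>) + 1) / real (Suc n) \<le> u + 1 / real (Suc n)"
proof -
  have "0 \<le> real (Suc n) * u" using assms by simp
  then have "real (nat \<lfloor>real (Suc n) * u\<rfloor>) \<le> real (Suc n) * u"
    "real (Suc n) * u < real (nat \<lfloor>real (Suc n) * u\<rfloor>) + 1"
    by linarith+
  then show "u < (real (nat \<lfloor>real (Suc n) * u\<rfloor>) + 1) / real (Suc n)"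
    "(real (nat \<lfloor>real (Suc n) * u\<rfloor>) + 1) / real (Suc n) \<le> u + 1 / real (Suc n)"
    by (simp_all add: field_simps del: of_nat_Suc)
qed

text \<open>Evaluation at the next grid time involves countably many times only, so each
  approximation is jointly measurable, and right-continuity makes the approximations converge
  pointwise. \<open>max 0 t\<close> extends the process to negative times, where nothing is assumed
  of it.\<close>

lemma measurable_right_cont_process:
  fixes Z :: "real \<Rightarrow> 'w \<Rightarrow> real"
  assumes meas: "\<And>t. 0 \<le> t \<Longrightarrow> Z t \<in> borel_measurable N"
    and rc: "\<And>\<omega>. \<omega> \<in> space N \<Longrightarrow> right_cont_path (\<lambda>t. Z t \<omega>)"
  shows "(\<lambda>(t, \<omega>). Z (max 0 t) \<omega>) \<in> borel_measurable (borel \<Otimes>\<^sub>M N)"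
proof (rule borel_measurable_LIMSEQ_real)
  let ?d = "\<lambda>n t. (real (nat \<lfloor>real (Suc n) * max 0 t\<rfloor>) + 1) / real (Suc n)"
  show "(\<lambda>(t, \<omega>). Z (?d n t) \<omega>) \<in> borel_measurable (borel \<Otimes>\<^sub>M N)" for n
  proof -
    have "(\<lambda>p. (\<lambda>i::nat. \<lambda>p. Z ((real i + 1) / real (Suc n)) (snd p)) (nat \<lfloor>real (Suc n) * max 0 (fst p)\<rfloor>) p)
        \<in> borel_measurable (borel \<Otimes>\<^sub>M N)"
      by (rule measurable_compose_countable)
        (auto intro!: measurable_compose[OF measurable_snd] meas)
    then show ?thesis by (simp add: case_prod_beta)
  qed
  fix p :: "real \<times> 'w" assume "p \<in> space (borel \<Otimes>\<^sub>M N)"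
  then obtain t \<omega> where p: "p = (t, \<omega>)" "\<omega> \<in> space N" by (auto simp: space_pair_measure)
  have "(\<lambda>n. ?d n t) \<longlonglongrightarrow> max 0 t"
  proof (rule tendsto_sandwich)
    have *: "max 0 t \<le> ?d n t" "?d n t \<le> max 0 t + 1 / real (Suc n)" for n
      using grid_above_bounds[of "max 0 t" n] by auto
    show "\<forall>\<^sub>F n in sequentially. max 0 t \<le> ?d n t" "\<forall>\<^sub>F n in sequentially. ?d n t \<le> max 0 t + 1 / real (Suc n)"
      using * by (auto intro: always_eventually)
    show "(\<lambda>n. max 0 t + 1 / real (Suc n)) \<longlonglongrightarrow> max 0 t"
      using tendsto_add[OF tendsto_const LIMSEQ_inverse_real_of_nat, of "max 0 t"] by (simp add: inverse_eq_divide)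
  qed auto
  moreover have "\<forall>\<^sub>F n in sequentially. ?d n t \<in> {max 0 t<..} \<and> ?d n t \<noteq> max 0 t"
  proof (intro always_eventually allI)
    show "?d n t \<in> {max 0 t<..} \<and> ?d n t \<noteq> max 0 t" for n
      by (metis grid_above_bounds(1) greaterThan_iff less_irrefl max.cobounded1)
  qed
  ultimately have "filterlim (\<lambda>n. ?d n t) (at_right (max 0 t)) sequentially"
    unfolding filterlim_at by blast
  from filterlim_compose[OF right_cont_path_tendsto[OF rc[OF p(2)]] this]
  show "(\<lambda>n. case p of (t, \<omega>) \<Rightarrow> Z (?d n t) \<omega>) \<longlonglongrightarrow> (case p of (t, \<omega>) \<Rightarrow> Z (max 0 t) \<omega>)"
    using p by simp
qed

text \<open>A single path is a process over the one-point space \<open>unit\<close>.\<close>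

lemma measurable_right_cont_path:
  assumes "right_cont_path f"
  shows "(\<lambda>t. f (max 0 t)) \<in> borel_measurable borel"
proof -
  have "(\<lambda>(t, \<omega>). (\<lambda>t _. f t) (max 0 t) \<omega>) \<in> borel_measurable (borel \<Otimes>\<^sub>M count_space (UNIV :: unit set))"
    using assms by (intro measurable_right_cont_process) auto
  then have "(\<lambda>t. (\<lambda>(t, \<omega>::unit). f (max 0 t)) (t, ())) \<in> borel_measurable borel"
    by (rule measurable_compose[rotated]) simp
  then show ?thesis by simp
qed

section \<open>The clock and its right-continuous inverse\<close>

text \<open>In this form the integrand is Borel on the whole line, as integration theory
  requires.\<close>

lemma clock_max0:
  "clock X t \<omega> = (\<integral>\<^sup>+s. inverse (ennreal (X (max 0 s) \<omega>)) * indicator {0..t} s \<partial>lborel)"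
  unfolding clock_def by (intro nn_integral_cong) (auto simp: indicator_def)

lemma clock_mono: "s \<le> t \<Longrightarrow> clock X s \<omega> \<le> clock X t \<omega>"
  unfolding clock_def by (intro nn_integral_mono) (auto simp: indicator_def)

lemma clock_0 [simp]: "clock X 0 \<omega> = 0"
proof -
  have "clock X 0 \<omega> = (\<integral>\<^sup>+s\<in>{0::real}. inverse (ennreal (X 0 \<omega>)) \<partial>lborel)"
    unfolding clock_def by (intro nn_integral_cong) (auto simp: indicator_def)
  then show ?thesis by (simp add: nn_integral_cmult_indicator)
qed

lemma clock_less_0: "t < 0 \<Longrightarrow> clock X t \<omega> = 0"
  unfolding clock_def by simp

text \<open>The value A(\<infinity>), which \<open>clock\<close> cannot express because its time
  argument is real.\<close>

definition clock_total :: "(real \<Rightarrow> 'w \<Rightarrow> real) \<Rightarrow> 'w \<Rightarrow> ennreal" where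
  "clock_total X \<omega> = (\<integral>\<^sup>+s\<in>{0..}. inverse (ennreal (X s \<omega>)) \<partial>lborel)"

lemma clock_total_max0:
  "clock_total X \<omega> = (\<integral>\<^sup>+s. inverse (ennreal (X (max 0 s) \<omega>)) * indicator {0..} s \<partial>lborel)"
  unfolding clock_total_def by (intro nn_integral_cong) (auto simp: indicator_def)

lemma clock_le_total: "clock X t \<omega> \<le> clock_total X \<omega>"
  unfolding clock_def clock_total_def by (intro nn_integral_mono) (auto simp: indicator_def)

text \<open>By monotonicity of the clock a witness of the infimum can be moved up to a rational.
  This turns events about \<theta> into countable unions of events about A.\<close>

lemma clock_inverse_less_iff:
  "clock_inverse X t \<omega> < y \<longleftrightarrow> (\<exists>q\<in>\<rat>. 0 \<le> q \<and> ennreal q < y \<and> ennreal t < clock X q \<omega>)"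
proof
  assume "clock_inverse X t \<omega> < y"
  then obtain s where s: "0 \<le> s" "clock X s \<omega> > ennreal t" "ennreal s < y"
    by (auto simp: clock_inverse_def INF_less_iff)
  obtain q where q: "q \<in> \<rat>" "s \<le> q" "ennreal q < y"
  proof (cases "y = top")
    case True
    then show ?thesis using that Rats_dense_in_real[of s "s + 1"] by force
  next
    case False
    then obtain r where r: "y = ennreal r" "r \<ge> 0" by (cases y) auto
    with s have "s < r" by (simp add: ennreal_less_iff)
    then show ?thesis using that Rats_dense_in_real[of s r] s r by (force simp: ennreal_less_iff)
  qed
  then show "\<exists>q\<in>\<rat>. 0 \<le> q \<and> ennreal q < y \<and> ennreal t < clock X q \<omega>"
    using s clock_mono[of s q X \<omega>] by force
qed (auto simp: clock_inverse_def INF_less_iff)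

lemma clock_inverse_mono: "s \<le> t \<Longrightarrow> clock_inverse X s \<omega> \<le> clock_inverse X t \<omega>"
  unfolding clock_inverse_def
  by (intro INF_superset_mono) (auto intro: le_less_trans ennreal_leI)

lemma clock_inverse_lower: "ennreal t < clock X s \<omega> \<Longrightarrow> 0 \<le> s \<Longrightarrow> clock_inverse X t \<omega> \<le> ennreal s"
  unfolding clock_inverse_def by (intro INF_lower) auto

lemma clock_le_if_less_inverse: 
  "0 \<le> s \<Longrightarrow> ennreal s < clock_inverse X t \<omega> \<Longrightarrow> clock X s \<omega> \<le> ennreal t"
  using clock_inverse_lower[of t X s \<omega>] by (force simp: not_le[symmetric])

lemma clock_inverse_eqI:
  assumes "\<And>s. 0 \<le> s \<Longrightarrow> ennreal t < clock X s \<omega> \<longleftrightarrow> ennreal t < clock Z s \<omega>'"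
  shows "clock_inverse X t \<omega> = clock_inverse Z t \<omega>'"
  unfolding clock_inverse_def using assms by (intro INF_cong) auto

lemma clock_cong: "(\<And>s. 0 \<le> s \<Longrightarrow> s \<le> t \<Longrightarrow> X s \<omega> = Z s \<omega>') \<Longrightarrow> clock X t \<omega> = clock Z t \<omega>'"
  unfolding clock_def by (intro nn_integral_cong) (auto simp: indicator_def)

lemma time_changed_cong:
  assumes "\<And>s. 0 \<le> s \<Longrightarrow> X s \<omega> = Z s \<omega>'"
  shows "time_changed X t \<omega> = time_changed Z t \<omega>'"
proof -
  have "clock X s \<omega> = clock Z s \<omega>'" for s using assms by (intro clock_cong) auto
  then have "clock_inverse X t \<omega> = clock_inverse Z t \<omega>'" by (intro clock_inverse_eqI) auto
  then show ?thesis using assms by (simp add: time_changed_def)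
qed

section \<open>Measurability of the clock and of the time change\<close>

context
  fixes Z :: "real \<Rightarrow> 'w \<Rightarrow> real" and N :: "'w measure"
  assumes meas: "\<And>t. 0 \<le> t \<Longrightarrow> Z t \<in> borel_measurable N"
    and rc: "\<And>\<omega>. \<omega> \<in> space N \<Longrightarrow> right_cont_path (\<lambda>t. Z t \<omega>)"
begin

lemma measurable_swapped_process:
  "(\<lambda>(\<omega>, t). Z (max 0 t) \<omega>) \<in> borel_measurable (N \<Otimes>\<^sub>M lborel)"
proof -
  have "(\<lambda>p. (\<lambda>(t, \<omega>). Z (max 0 t) \<omega>) (snd p, fst p)) \<in> borel_measurable (N \<Otimes>\<^sub>M lborel)"
    by (rule measurable_compose[OF _ measurable_right_cont_process[OF meas rc]]) auto
  then show ?thesis by (simp add: case_prod_beta)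
qed

lemma measurable_clock: "clock Z t \<in> borel_measurable N"
proof -
  note measurable_swapped_process[measurable]
  have "(\<lambda>\<omega>. \<integral>\<^sup>+s. inverse (ennreal (Z (max 0 s) \<omega>)) * indicator {0..t} s \<partial>lborel) \<in> borel_measurable N"
    by measurable
  then show ?thesis unfolding clock_max0[abs_def] .
qed

lemma measurable_clock_total: "clock_total Z \<in> borel_measurable N"
proof -
  note measurable_swapped_process[measurable]
  have "(\<lambda>\<omega>. \<integral>\<^sup>+s. inverse (ennreal (Z (max 0 s) \<omega>)) * indicator {0..} s \<partial>lborel) \<in> borel_measurable N"
    by measurable
  then show ?thesis unfolding clock_total_max0[abs_def] .
qed

lemma measurable_clock_inverse: "clock_inverse Z t \<in> borel_measurable N"
proof (rule borel_measurableI_less)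
  fix y
  note measurable_clock[measurable]
  have "{\<omega> \<in> space N. clock_inverse Z t \<omega> < y} =
      (\<Union>q\<in>{q\<in>\<rat>. 0 \<le> q \<and> ennreal q < y}. {\<omega> \<in> space N. ennreal t < clock Z q \<omega>})"
    by (auto simp: clock_inverse_less_iff)
  also have "\<dots> \<in> sets N"
    by (rule sets.countable_UN') (auto intro: countable_subset[OF _ countable_rat])
  finally show "{\<omega> \<in> space N. clock_inverse Z t \<omega> < y} \<in> sets N" .
qed

text \<open>A jointly measurable process is evaluated at a measurable random time;
  \<open>max 0\<close> disappears because \<open>enn2real\<close> is nonnegative.\<close>

lemma measurable_time_changed: "time_changed Z t \<in> borel_measurable N"
proof -
  note measurable_clock_inverse[measurable]
  have "(\<lambda>\<omega>. (\<lambda>(t, \<omega>). Z (max 0 t) \<omega>) (enn2real (clock_inverse Z t \<omega>), \<omega>)) \<in> borel_measurable N"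
    by (rule measurable_compose[OF _ measurable_right_cont_process[OF meas rc]]) auto
  then have [measurable]: "(\<lambda>\<omega>. Z (enn2real (clock_inverse Z t \<omega>)) \<omega>) \<in> borel_measurable N"
    by simp
  show ?thesis unfolding time_changed_def[abs_def] by measurable
qed

end

text \<open>Path functionals are handled on the trace of the path space on the right-continuous paths,
  which are not a measurable subset of it.\<close>

definition right_cont_paths :: "(real \<Rightarrow> real) measure" where
  "right_cont_paths = restrict_space path_space {f. right_cont_path f}"

lemma right_cont_path_cong:
  assumes "\<And>t. 0 \<le> t \<Longrightarrow> f t = g t"
  shows "right_cont_path f \<longleftrightarrow> right_cont_path g"
proof -
  have "continuous (at_right t) f \<longleftrightarrow> continuous (at_right t) g" if "0 \<le> t" for t
    unfolding continuous_within using that assms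
    by (intro filterlim_cong) (auto simp: eventually_at_filter)
  then show ?thesis by (auto simp: right_cont_path_def)
qed

lemma sample_path_right_cont:
  "right_cont_path (\<lambda>t. X t \<omega>) \<Longrightarrow> right_cont_path (sample_path X \<omega>)"
  using right_cont_path_cong[of "sample_path X \<omega>" "\<lambda>t. X t \<omega>"] by (auto simp: sample_path_def)

lemma measurable_coord_right_cont_paths:
  "0 \<le> t \<Longrightarrow> (\<lambda>f. f t) \<in> borel_measurable right_cont_paths"
  unfolding right_cont_paths_def by (intro measurable_restrict_space1 measurable_component_singleton) auto

lemma space_right_cont_paths: "f \<in> space right_cont_paths \<Longrightarrow> right_cont_path f"
  by (auto simp: right_cont_paths_def space_restrict_space)

text \<open>Laws and the Markov property are stated for events of \<open>path_space\<close>. A trace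
  event extends to such an event \<open>C\<close>, and right-continuous samples cannot tell the two
  apart.\<close>

lemma right_cont_paths_set_lift:
  assumes "A \<in> sets right_cont_paths"
  obtains C where "C \<in> sets path_space"
    "\<And>X \<omega>. right_cont_path (\<lambda>t. X t \<omega>) \<Longrightarrow> sample_path X \<omega> \<in> C \<longleftrightarrow> sample_path X \<omega> \<in> A"
proof -
  from assms obtain C where C: "C \<in> sets path_space" "A = {f. right_cont_path f} \<inter> C"
    by (auto simp: right_cont_paths_def sets_restrict_space)
  show ?thesis by (rule that[OF C(1)]) (simp add: C(2) sample_path_right_cont)
qed

lemma clock_total_sample_path: "clock_total (\<lambda>t f. f t) (sample_path X \<omega>) = clock_total X \<omega>"
  unfolding clock_total_def sample_path_def by (intro nn_integral_cong) (auto simp: indicator_def)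

lemma time_changed_sample_path: "time_changed (\<lambda>t f. f t) t (sample_path X \<omega>) = time_changed X t \<omega>"
  by (rule time_changed_cong) (simp add: sample_path_def)

section \<open>Paths of the time-changed process\<close>

text \<open>A time \<open>q\<close> witnessing \<theta>(t) < y has A(q) > t, and this strict
  inequality persists for \<open>u\<close> slightly above \<open>t\<close>.\<close>

lemma clock_inverse_right_cont:
  assumes "clock_inverse X t \<omega> < y" 
  shows "\<forall>\<^sub>F u in at_right t. clock_inverse X u \<omega> < y"
proof -
  from assms obtain q where q: "0 \<le> q" "ennreal q < y" "ennreal t < clock X q \<omega>"
    by (auto simp: clock_inverse_less_iff)
  have "\<exists>b>t. \<forall>u. t < u \<and> u < b \<longrightarrow> ennreal u < clock X q \<omega>"
  proof (cases "clock X q \<omega>")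
    case (real r)
    then show ?thesis using q by (intro exI[of _ "max r 0"]) (auto simp: ennreal_less_iff, (smt (verit) ennreal_less_iff ennreal_neg not_less_zero)+)
  next
    case top
    then show ?thesis by (auto intro!: exI[of _ "t + 1"])
  qed
  then obtain b where b: "b > t" "\<And>u. t < u \<Longrightarrow> u < b \<Longrightarrow> ennreal u < clock X q \<omega>" by auto
  have "clock_inverse X u \<omega> < y" if "t < u" "u < b" for u
    using clock_inverse_lower[OF b(2)[OF that] q(1)] q(2) by simp
  with b(1) show ?thesis by (auto simp: eventually_at_right_field)
qed

text \<open>\<theta> is nondecreasing and right-continuous, so its composition with a
  right-continuous path is right-continuous. Once \<theta> is infinite it stays so, and the path is
  constantly 0.\<close>

lemma time_changed_right_cont:
  assumes rc: "right_cont_path (\<lambda>t. X t \<omega>)"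
  shows "right_cont_path (\<lambda>t. time_changed X t \<omega>)"
  unfolding right_cont_path_def continuous_within
proof (intro allI impI)
  fix t :: real assume t: "0 \<le> t"
  show "((\<lambda>t. time_changed X t \<omega>) \<longlongrightarrow> time_changed X t \<omega>) (at_right t)"
  proof (cases "clock_inverse X t \<omega>")
    case top
    have "time_changed X u \<omega> = time_changed X t \<omega>" if "u > t" for u
      using clock_inverse_mono[of t u X \<omega>] that top by (simp add: time_changed_def top_unique)
    then show ?thesis
      by (intro tendsto_eventually) (auto simp: eventually_at_filter)
  next
    case (real r)
    show ?thesis
    proof (rule topological_tendstoI)
      fix S assume S: "open S" "time_changed X t \<omega> \<in> S"
      have "time_changed X t \<omega> = X r \<omega>" using real by (simp add: time_changed_def)
      then have "\<forall>\<^sub>F u in at_right r. X u \<omega> \<in> S"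
        using S topological_tendstoD[OF right_cont_path_tendsto[OF rc, of r]] real by auto
      then obtain b where b: "b > r" "\<And>u. r < u \<Longrightarrow> u < b \<Longrightarrow> X u \<omega> \<in> S"
        by (auto simp: eventually_at_right_field)
      have "clock_inverse X t \<omega> < ennreal b" using real b by (simp add: ennreal_less_iff)
      from clock_inverse_right_cont[OF this]
      show "\<forall>\<^sub>F u in at_right t. time_changed X u \<omega> \<in> S"
      proof (rule eventually_mp[rotated], intro eventually_at_rightI[of t "t + 1"] impI)
        fix u assume u: "u \<in> {t<..<t + 1}" "clock_inverse X u \<omega> < ennreal b"
        obtain v where v: "clock_inverse X u \<omega> = ennreal v" "0 \<le> v"
          using u by (cases "clock_inverse X u \<omega>") auto
        have "r \<le> v" using clock_inverse_mono[of t u X \<omega>] u real v by simp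
        moreover have "v < b" using u v by (simp add: ennreal_less_iff)
        \<comment> \<open>The case \<open>v = r\<close> occurs where \<theta> is constant to the
          right of \<open>t\<close>; the punctured neighbourhood of \<open>r\<close> does not cover
          it.\<close>
        ultimately have "X v \<omega> \<in> S"
          using b S \<open>time_changed X t \<omega> = X r \<omega>\<close> by (cases "v = r") auto
        then show "time_changed X u \<omega> \<in> S" using v by (simp add: time_changed_def)
      qed simp
    qed
  qed
qed

lemma time_changed_nonneg:
  "(\<And>s. 0 \<le> s \<Longrightarrow> 0 \<le> X s \<omega>) \<Longrightarrow> 0 \<le> time_changed X t \<omega>"
  by (simp add: time_changed_def)

lemma time_changed_absorbed:
  assumes abs: "\<And>s t. 0 \<le> s \<Longrightarrow> s \<le> t \<Longrightarrow> X s \<omega> = 0 \<Longrightarrow> X t \<omega> = 0"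
    and "s \<le> t" "time_changed X s \<omega> = 0"
  shows "time_changed X t \<omega> = 0"
proof (cases "clock_inverse X t \<omega> = \<infinity>")
  case False
  have le: "clock_inverse X s \<omega> \<le> clock_inverse X t \<omega>" by (rule clock_inverse_mono) fact
  with False have s: "clock_inverse X s \<omega> \<noteq> \<infinity>" by (auto simp: top_unique)
  have "enn2real (clock_inverse X s \<omega>) \<le> enn2real (clock_inverse X t \<omega>)"
    using le False by (intro enn2real_mono) (auto simp: less_top)
  then show ?thesis using abs[of "enn2real (clock_inverse X s \<omega>)" "enn2real (clock_inverse X t \<omega>)"] assms s False
    by (simp add: time_changed_def)
qed (simp add: time_changed_def)

lemma clock_total_SUP:
  assumes "right_cont_path (\<lambda>t. X t \<omega>)"
  shows "clock_total X \<omega> = (SUP n. clock X (real n) \<omega>)"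
proof -
  note [measurable] = measurable_right_cont_path[OF assms]
  let ?f = "\<lambda>s. inverse (ennreal (X (max 0 s) \<omega>))"
  have "?f s * indicator {0..} s = (SUP n. ?f s * indicator {0..real n} s)" for s
  proof (rule antisym)
    obtain n where "s \<le> real n" using real_arch_simple by blast
    then show "?f s * indicator {0..} s \<le> (SUP n. ?f s * indicator {0..real n} s)"
      by (intro SUP_upper2[of n]) (auto simp: indicator_def)
  qed (intro SUP_least mult_left_mono; auto simp: indicator_def)
  then have "clock_total X \<omega> = (\<integral>\<^sup>+s. (SUP n. ?f s * indicator {0..real n} s) \<partial>lborel)"
    unfolding clock_total_max0 by simp
  also have "\<dots> = (SUP n. \<integral>\<^sup>+s. ?f s * indicator {0..real n} s \<partial>lborel)"
    by (intro nn_integral_monotone_convergence_SUP incseq_SucI le_funI mult_left_mono)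
      (auto simp: indicator_def)
  finally show ?thesis unfolding clock_max0 .
qed

lemma clock_total_leI:
  "right_cont_path (\<lambda>t. X t \<omega>) \<Longrightarrow> (\<And>s. 0 \<le> s \<Longrightarrow> clock X s \<omega> \<le> c) \<Longrightarrow> clock_total X \<omega> \<le> c"
  by (subst clock_total_SUP) (auto intro!: SUP_least)

text \<open>As \<open>u\<close> increases to \<open>t\<close>, \<theta>(u) increases to
  \<open>m\<close>. Either \<open>m\<close> is attained before \<open>t\<close>, and the path is
  constant just before \<open>t\<close>, or \<theta>(u) approaches \<open>m\<close> strictly from
  the left, and the left limit of \<open>X\<close> at \<open>m\<close> is the limit sought.\<close>

lemma time_changed_left_limits:
  assumes rc: "right_cont_path (\<lambda>t. X t \<omega>)"
    and ll: "left_limits_path (\<lambda>t. X t \<omega>)" and total: "clock_total X \<omega> = \<infinity>"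
  shows "left_limits_path (\<lambda>t. time_changed X t \<omega>)"
  unfolding left_limits_path_def
proof (intro allI impI)
  fix t :: real assume t: "0 < t"
  define m where "m = (SUP u\<in>{..<t}. clock_inverse X u \<omega>)"
  have le_m: "clock_inverse X u \<omega> \<le> m" if "u < t" for u
    unfolding m_def using that by (intro SUP_upper) auto
  have less_m: "\<exists>u<t. y < clock_inverse X u \<omega>" if "y < m" for y
    using that unfolding m_def less_SUP_iff by auto
  show "\<exists>l. ((\<lambda>t. time_changed X t \<omega>) \<longlongrightarrow> l) (at_left t)"
  proof (cases "\<exists>u<t. clock_inverse X u \<omega> = m")
    case True
    then obtain u where u: "u < t" "clock_inverse X u \<omega> = m" by auto
    have "clock_inverse X v \<omega> = m" if "v \<in> {u<..<t}" for v
      using clock_inverse_mono[of u v X \<omega>] le_m[of v] u that by auto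
    then have "\<forall>v. u < v \<and> v < t \<longrightarrow> time_changed X v \<omega> = time_changed X u \<omega>"
      using u by (auto simp: time_changed_def)
    with u(1) have "\<forall>\<^sub>F v in at_left t. time_changed X v \<omega> = time_changed X u \<omega>"
      unfolding eventually_at_left_field by blast
    then show ?thesis by (blast intro: tendsto_eventually)
  next
    case False
    with le_m have lt: "clock_inverse X u \<omega> < m" if "u < t" for u using that by (force simp: less_le)
    \<comment> \<open>If \<open>m\<close> were infinite, every real \<open>s\<close> would lie below
      some \<theta>(u) with u < t, so A would be bounded by \<open>t\<close>, against the infinite
      total clock.\<close>
    have "m \<noteq> \<infinity>"
    proof
      assume "m = \<infinity>"
      have "clock X s \<omega> \<le> ennreal t" if "0 \<le> s" for s
      proof -
        have "ennreal s < m" using \<open>m = \<infinity>\<close> by simp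
        with less_m obtain u where u: "u < t" "ennreal s < clock_inverse X u \<omega>" by blast
        then have "clock X s \<omega> \<le> ennreal u" using that by (intro clock_le_if_less_inverse)
        also have "\<dots> \<le> ennreal t" using u by (intro ennreal_leI) auto
        finally show ?thesis .
      qed
      then have "clock_total X \<omega> \<le> ennreal t" by (rule clock_total_leI[of X \<omega>, OF rc])
      with total show False by (simp add: top_unique)
    qed
    then obtain r where r: "m = ennreal r" "0 \<le> r" by (cases m) auto
    \<comment> \<open>Left limits are available at positive times only; \<theta>(0) < m makes
      \<open>r\<close> positive.\<close>
    have "r > 0" using lt[OF t] r by (auto simp: less_le)
    with ll obtain l where l: "((\<lambda>t. X t \<omega>) \<longlongrightarrow> l) (at_left r)" by (auto simp: left_limits_path_def)
    have "((\<lambda>t. time_changed X t \<omega>) \<longlongrightarrow> l) (at_left t)"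
    proof (rule topological_tendstoI)
      fix S assume "open S" "l \<in> S"
      from topological_tendstoD[OF l this] obtain b where
        b: "b < r" "\<And>u. b < u \<Longrightarrow> u < r \<Longrightarrow> X u \<omega> \<in> S"
        by (auto simp: eventually_at_left_field)
      have "ennreal (max b 0) < m" using b \<open>r > 0\<close> r by (simp add: ennreal_lessI)
      with less_m obtain u where u: "u < t" "ennreal (max b 0) < clock_inverse X u \<omega>" by blast
      have "time_changed X v \<omega> \<in> S" if v: "u < v" "v < t" for v
      proof -
        have "ennreal (max b 0) < clock_inverse X v \<omega>"
          using u clock_inverse_mono[of u v X \<omega>] v by simp
        moreover have "clock_inverse X v \<omega> < ennreal r" using lt[OF v(2)] r by simp
        ultimately obtain w where w: "clock_inverse X v \<omega> = ennreal w" "0 \<le> w" "w < r"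
          "ennreal (max b 0) < ennreal w"
          by (cases "clock_inverse X v \<omega>") (auto simp: ennreal_less_iff)
        then have "\<not> w \<le> max b 0" using ennreal_leI[of w "max b 0"] by (auto simp: not_le[symmetric])
        then show ?thesis using b(2)[of w] w by (simp add: time_changed_def)
      qed
      with u(1) show "\<forall>\<^sub>F v in at_left t. time_changed X v \<omega> \<in> S"
        unfolding eventually_at_left_field by blast
    qed
    then show ?thesis by blast
  qed
qed

text \<open>\<open>X\<close> takes real values, so the integrand 1/X vanishes nowhere in
  \<open>ennreal\<close>.\<close>

lemma clock_pos: "right_cont_path (\<lambda>t. X t \<omega>) \<Longrightarrow> 0 < t \<Longrightarrow> 0 < clock X t \<omega>"
proof -
  assume rc: "right_cont_path (\<lambda>t. X t \<omega>)" and t: "0 < t"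
  note [measurable] = measurable_right_cont_path[OF rc]
  have "clock X t \<omega> \<noteq> 0"
  proof
    assume "clock X t \<omega> = 0"
    then have "AE s in lborel. s \<notin> {0..t}"
      unfolding clock_max0 by (subst (asm) nn_integral_0_iff_AE) (auto simp: indicator_def)
    then have "emeasure lborel {0..t} = 0"
      by (subst (asm) AE_iff_measurable[OF _ refl]) (auto simp: atLeastAtMost_def atLeast_def atMost_def Int_def)
    with t show False by simp
  qed
  then show ?thesis by (simp add: zero_less_iff_neq_zero)
qed

lemma clock_total_pos: "right_cont_path (\<lambda>t. X t \<omega>) \<Longrightarrow> 0 < clock_total X \<omega>"
  using clock_pos[of X \<omega> 1] clock_le_total[of X 1 \<omega>] by simp

text \<open>The clock is positive at every positive time, hence \<theta>(0) = 0.\<close>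

lemma time_changed_0:
  assumes "right_cont_path (\<lambda>t. X t \<omega>)"
  shows "time_changed X 0 \<omega> = X 0 \<omega>"
proof -
  have "clock_inverse X 0 \<omega> \<le> 0"
  proof (rule ennreal_le_epsilon)
    fix e :: real assume "0 < e"
    then show "clock_inverse X 0 \<omega> \<le> 0 + ennreal e"
      using clock_inverse_lower[of 0 X e \<omega>] clock_pos[of X \<omega>, OF assms] by simp
  qed
  then show ?thesis by (simp add: time_changed_def)
qed

section \<open>Scaling of the clock and of the time change\<close>

text \<open>The factor 1/k comes from the integrand, the factor 1/c from a linear
  substitution.\<close>

lemma clock_scale:
  assumes "right_cont_path (\<lambda>t. X t \<omega>)" "0 < k" "0 < c"
  shows "clock (\<lambda>t \<omega>. k * X (c * t) \<omega>) s \<omega> = ennreal (inverse (k * c)) * clock X (c * s) \<omega>"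
    and "clock_total (\<lambda>t \<omega>. k * X (c * t) \<omega>) \<omega> = ennreal (inverse (k * c)) * clock_total X \<omega>"
proof -
  note [measurable] = measurable_right_cont_path[OF assms(1)]
  have inv: "inverse (ennreal (k * y)) = ennreal (inverse k) * inverse (ennreal y)" for y
    using assms by (simp add: ennreal_mult' ennreal_inverse_mult' inverse_ennreal)
  \<comment> \<open>Stated for a general set \<open>A\<close>, so that it covers both the clock up
    to \<open>s\<close> and the total clock.\<close>
  have *: "(\<integral>\<^sup>+u. inverse (ennreal (k * X (max 0 (c * u)) \<omega>)) * indicator A (c * u) \<partial>lborel) =
      ennreal (inverse (k * c)) * (\<integral>\<^sup>+u. inverse (ennreal (X (max 0 u) \<omega>)) * indicator A u \<partial>lborel)"
    if [measurable]: "A \<in> sets borel" for A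
  proof -
    have "(\<integral>\<^sup>+u. inverse (ennreal (X (max 0 u) \<omega>)) * indicator A u \<partial>lborel) =
      ennreal c * (\<integral>\<^sup>+u. inverse (ennreal (X (max 0 (c * u)) \<omega>)) * indicator A (c * u) \<partial>lborel)"
      using assms by (subst nn_integral_real_affine[where c=c and t=0]) auto
    moreover have "(\<integral>\<^sup>+u. inverse (ennreal (k * X (max 0 (c * u)) \<omega>)) * indicator A (c * u) \<partial>lborel) =
      ennreal (inverse k) * (\<integral>\<^sup>+u. inverse (ennreal (X (max 0 (c * u)) \<omega>)) * indicator A (c * u) \<partial>lborel)"
      by (subst nn_integral_cmult[symmetric]) (auto simp: inv mult.assoc)
    moreover have "ennreal (inverse (k * c)) * ennreal c = ennreal (inverse k)"
      using assms by (simp add: ennreal_mult'[symmetric] field_simps)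
    ultimately show ?thesis by (simp add: mult.assoc[symmetric])
  qed
  have "clock (\<lambda>t \<omega>. k * X (c * t) \<omega>) s \<omega> =
    (\<integral>\<^sup>+u. inverse (ennreal (k * X (max 0 (c * u)) \<omega>)) * indicator {0..c * s} (c * u) \<partial>lborel)"
    unfolding clock_def using assms
    by (intro nn_integral_cong) (auto simp: indicator_def zero_le_mult_iff)
  then show "clock (\<lambda>t \<omega>. k * X (c * t) \<omega>) s \<omega> = ennreal (inverse (k * c)) * clock X (c * s) \<omega>"
    by (simp add: * clock_max0)
  have "clock_total (\<lambda>t \<omega>. k * X (c * t) \<omega>) \<omega> =
    (\<integral>\<^sup>+u. inverse (ennreal (k * X (max 0 (c * u)) \<omega>)) * indicator {0..} (c * u) \<partial>lborel)"
    unfolding clock_total_def using assms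
    by (intro nn_integral_cong) (auto simp: indicator_def zero_le_mult_iff)
  then show "clock_total (\<lambda>t \<omega>. k * X (c * t) \<omega>) \<omega> = ennreal (inverse (k * c)) * clock_total X \<omega>"
    by (simp add: * clock_total_max0)
qed

lemma ennreal_mult_less_cancel_pos:
  assumes "0 < c"
  shows "ennreal c * a < ennreal c * b \<longleftrightarrow> a < b"
proof
  show "ennreal c * a < ennreal c * b \<Longrightarrow> a < b"
    by (meson mult_left_mono not_le zero_le)
qed (use assms in \<open>auto intro: ennreal_mult_strict_left_mono\<close>)

text \<open>Multiplication by a finite positive constant has a monotone inverse, so it commutes with
  infima, including the empty one with value \<infinity>.\<close>

lemma INF_ennreal_const_mult_pos:
  fixes f :: "'a \<Rightarrow> ennreal"
  assumes "0 < c"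
  shows "(INF i\<in>I. ennreal c * f i) = ennreal c * (INF i\<in>I. f i)"
proof (rule antisym)
  have cancel: "ennreal (inverse c) * (ennreal c * y) = y" "ennreal c * (ennreal (inverse c) * y) = y" for y
    using assms by (simp_all add: mult.assoc[symmetric] ennreal_mult'[symmetric])
  have "ennreal (inverse c) * (INF i\<in>I. ennreal c * f i) \<le> (INF i\<in>I. f i)"
  proof (rule INF_greatest)
    fix i assume "i \<in> I"
    then have "ennreal (inverse c) * (INF i\<in>I. ennreal c * f i) \<le> ennreal (inverse c) * (ennreal c * f i)"
      by (intro mult_left_mono INF_lower) auto
    then show "ennreal (inverse c) * (INF i\<in>I. ennreal c * f i) \<le> f i" by (simp add: cancel)
  qed
  then have "ennreal c * (ennreal (inverse c) * (INF i\<in>I. ennreal c * f i)) \<le> ennreal c * (INF i\<in>I. f i)"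
    by (rule mult_left_mono) simp
  then show "(INF i\<in>I. ennreal c * f i) \<le> ennreal c * (INF i\<in>I. f i)" by (simp add: cancel)
qed (intro INF_greatest mult_left_mono INF_lower; simp)

text \<open>The scaled clock exceeds \<open>t\<close> at \<open>s\<close> exactly when the original
  one exceeds \<open>k * c * t\<close> at \<open>c * s\<close>, so the sets of times differ by the
  factor 1/c.\<close>

lemma clock_inverse_scale:
  assumes "right_cont_path (\<lambda>t. X t \<omega>)" "0 < k" "0 < c" "0 \<le> t"
  shows "clock_inverse (\<lambda>t \<omega>. k * X (c * t) \<omega>) t \<omega> = ennreal (inverse c) * clock_inverse X (k * c * t) \<omega>"
proof -
  let ?Z = "\<lambda>t \<omega>. k * X (c * t) \<omega>"
  have iff: "ennreal t < clock ?Z s \<omega> \<longleftrightarrow> ennreal (k * c * t) < clock X (c * s) \<omega>" for s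
  proof -
    have "ennreal t < clock ?Z s \<omega> \<longleftrightarrow> ennreal (k * c) * ennreal t < ennreal (k * c) * clock ?Z s \<omega>"
      using assms by (simp add: ennreal_mult_less_cancel_pos)
    also have "ennreal (k * c) * clock ?Z s \<omega> = clock X (c * s) \<omega>"
    proof -
      have "ennreal (k * c) * ennreal (inverse (k * c)) = 1"
        using assms by (subst ennreal_mult'[symmetric]) (auto simp: field_simps)
      then show ?thesis
        using assms clock_scale(1)[of X \<omega> k c s] by (simp add: mult.assoc[symmetric])
    qed
    also have "ennreal (k * c) * ennreal t = ennreal (k * c * t)"
      using assms by (simp add: ennreal_mult')
    finally show ?thesis .
  qed
  have "{s. 0 \<le> s \<and> clock ?Z s \<omega> > ennreal t} = (\<lambda>s. inverse c * s) ` {s. 0 \<le> s \<and> clock X s \<omega> > ennreal (k * c * t)}"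
    (is "?A = _ ` ?B")
  proof (intro set_eqI iffI)
    fix s assume "s \<in> ?A"
    then show "s \<in> (\<lambda>s. inverse c * s) ` ?B"
      using assms by (intro image_eqI[of _ _ "c * s"]) (auto simp: iff)
  next
    fix s assume "s \<in> (\<lambda>s. inverse c * s) ` ?B"
    then show "s \<in> ?A" using assms by (auto simp: iff mult.assoc[symmetric])
  qed
  then have "clock_inverse ?Z t \<omega> = (INF s\<in>?B. ennreal (inverse c) * ennreal s)"
    unfolding clock_inverse_def
    using assms by (auto simp: image_image ennreal_mult' intro!: INF_cong)
  also have "\<dots> = ennreal (inverse c) * clock_inverse X (k * c * t) \<omega>"
    unfolding clock_inverse_def using assms
    by (simp add: INF_ennreal_const_mult_pos)
  finally show ?thesis .
qed

text \<open>The factor \<open>c\<close> inside \<open>X\<close> cancels against the factor 1/c of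
  \<theta>, and only the time scale \<open>k * c\<close> remains. For
  \<open>c = k powr (-\<alpha>)\<close> this is \<open>k powr (-(\<alpha> - 1))\<close>, which is
  how the index drops by one.\<close>

lemma time_changed_scale:
  assumes "right_cont_path (\<lambda>t. X t \<omega>)" "0 < k" "0 < c" "0 \<le> t"
  shows "time_changed (\<lambda>t \<omega>. k * X (c * t) \<omega>) t \<omega> = k * time_changed X (k * c * t) \<omega>"
  unfolding time_changed_def clock_inverse_scale[of X \<omega>, OF assms] using assms
  by (cases "clock_inverse X (k * c * t) \<omega>")
     (auto simp: ennreal_mult_top ennreal_mult'[symmetric] mult.assoc[symmetric])

section \<open>Restarting a path at a later time\<close>

lemma right_cont_path_shift:
  assumes "right_cont_path f" "0 \<le> S"
  shows "right_cont_path (\<lambda>u. f (S + u))"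
  unfolding right_cont_path_def continuous_within
proof (intro allI impI)
  fix t :: real assume "0 \<le> t"
  have "filterlim (\<lambda>u. S + u) (at_right (S + t)) (at_right t)"
    unfolding filterlim_at by (auto intro!: tendsto_intros simp: eventually_at_filter)
  from filterlim_compose[OF right_cont_path_tendsto[OF assms(1)] this]
  show "((\<lambda>u. f (S + u)) \<longlongrightarrow> f (S + t)) (at_right t)"
    using \<open>0 \<le> t\<close> assms by simp
qed

lemma
  assumes rc: "right_cont_path (\<lambda>t. X t \<omega>)" and S: "0 \<le> S"
  shows clock_add: "0 \<le> v \<Longrightarrow> clock X (S + v) \<omega> = clock X S \<omega> + clock (\<lambda>u. X (S + u)) v \<omega>"
    and clock_total_add: "clock_total X \<omega> = clock X S \<omega> + clock_total (\<lambda>u. X (S + u)) \<omega>"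
proof -
  note [measurable] = measurable_right_cont_path[OF rc]
  let ?g = "\<lambda>s. inverse (ennreal (X (max 0 s) \<omega>))"
  \<comment> \<open>Again for a general set \<open>A\<close>. The point \<open>S\<close> is excluded
    because it belongs to \<open>{0..S}\<close> and possibly also to the shifted set; a single point
    is null.\<close>
  have *: "(\<integral>\<^sup>+s. ?g s * indicator B s \<partial>lborel) =
      clock X S \<omega> + (\<integral>\<^sup>+u. ?g (S + u) * indicator A u \<partial>lborel)"
    if [measurable]: "A \<in> sets borel" "B \<in> sets borel"
      and AB: "\<And>s. s \<noteq> S \<Longrightarrow> s \<in> B \<longleftrightarrow> s \<in> {0..S} \<or> s - S \<in> A" "\<And>s. s \<in> A \<Longrightarrow> 0 \<le> s" for A B
  proof -
    have "(\<integral>\<^sup>+s. ?g s * indicator B s \<partial>lborel) =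
        (\<integral>\<^sup>+s. ?g s * indicator {0..S} s + ?g s * indicator A (s - S) \<partial>lborel)"
    proof (rule nn_integral_cong_AE, use AE_lborel_singleton[of S] in eventually_elim)
      fix s :: real assume "s \<noteq> S"
      moreover have "s < S" if "s \<noteq> S" "s - S \<notin> A" "s \<in> {0..S}" using that by auto
      moreover have "s \<notin> {0..S}" if "s \<noteq> S" "s - S \<in> A" using that AB(2)[of "s - S"] by auto
      ultimately show "?g s * indicator B s = ?g s * indicator {0..S} s + ?g s * indicator A (s - S)"
        using AB(1)[of s] by (auto simp: indicator_def)
    qed
    also have "\<dots> = clock X S \<omega> + (\<integral>\<^sup>+s. ?g s * indicator A (s - S) \<partial>lborel)"
      by (subst nn_integral_add) (auto simp: clock_max0)
    also have "(\<integral>\<^sup>+s. ?g s * indicator A (s - S) \<partial>lborel) = (\<integral>\<^sup>+u. ?g (S + u) * indicator A u \<partial>lborel)"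
      by (subst nn_integral_real_affine[where c=1 and t=S]) auto
    finally show ?thesis .
  qed
  show "clock X (S + v) \<omega> = clock X S \<omega> + clock (\<lambda>u. X (S + u)) v \<omega>" if "0 \<le> v"
  proof -
    have "clock (\<lambda>u. X (S + u)) v \<omega> = (\<integral>\<^sup>+u. ?g (S + u) * indicator {0..v} u \<partial>lborel)"
      unfolding clock_def using S by (intro nn_integral_cong) (auto simp: indicator_def)
    then show ?thesis
      unfolding clock_max0[of X "S + v"] using that S by (subst *[where A="{0..v}"]) auto
  qed
  have "clock_total (\<lambda>u. X (S + u)) \<omega> = (\<integral>\<^sup>+u. ?g (S + u) * indicator {0..} u \<partial>lborel)"
    unfolding clock_total_def using S by (intro nn_integral_cong) (auto simp: indicator_def)
  then show "clock_total X \<omega> = clock X S \<omega> + clock_total (\<lambda>u. X (S + u)) \<omega>"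
    unfolding clock_total_max0[of X] using S by (subst *[where A="{0..}"]) auto
qed

text \<open>Left-continuity of the clock, by monotone convergence; it includes times at which the
  clock is already infinite.\<close>

lemma clock_left_SUP:
  assumes rc: "right_cont_path (\<lambda>t. X t \<omega>)"
  shows "clock X t \<omega> = (SUP n. clock X (t - 1 / real (Suc n)) \<omega>)"
proof -
  note [measurable] = measurable_right_cont_path[OF rc]
  let ?f = "\<lambda>s. inverse (ennreal (X (max 0 s) \<omega>))"
  let ?r = "\<lambda>n. t - 1 / real (Suc n)"
  have eq: "?f s * indicator {0..t} s = (SUP n. ?f s * indicator {0..?r n} s)" if "s \<noteq> t" for s
  proof (rule antisym)
    have "\<exists>n. ?f s * indicator {0..t} s \<le> ?f s * indicator {0..?r n} s"
    proof (cases "s < t")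
      case True
      then obtain n where "inverse (real (Suc n)) < t - s" using reals_Archimedean[of "t - s"] by auto
      then show ?thesis by (intro exI[of _ n]) (auto simp: indicator_def inverse_eq_divide)
    qed (use that in auto)
    then show "?f s * indicator {0..t} s \<le> (SUP n. ?f s * indicator {0..?r n} s)"
      by (blast intro: SUP_upper2)
    show "(SUP n. ?f s * indicator {0..?r n} s) \<le> ?f s * indicator {0..t} s"
      by (intro SUP_least mult_left_mono) (auto simp: indicator_def intro: order_trans)
  qed
  have "clock X t \<omega> = (\<integral>\<^sup>+s. (SUP n. ?f s * indicator {0..?r n} s) \<partial>lborel)"
    unfolding clock_max0
    by (rule nn_integral_cong_AE, use AE_lborel_singleton[of t] in eventually_elim) (rule eq)
  also have "\<dots> = (SUP n. \<integral>\<^sup>+s. ?f s * indicator {0..?r n} s \<partial>lborel)"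
  proof (intro nn_integral_monotone_convergence_SUP incseq_SucI le_funI mult_left_mono)
    have "?r n \<le> ?r (Suc n)" for n by (simp add: field_simps)
    then show "indicator {0..?r n} s \<le> (indicator {0..?r (Suc n)} s :: ennreal)" for n s
      by (auto simp: indicator_def intro: order_trans)
  qed auto
  finally show ?thesis unfolding clock_max0 .
qed

text \<open>Before \<open>S\<close> the clock is at most \<open>T\<close>, and left-continuity
  carries this to \<open>S\<close>. Conversely the clock reaches \<open>T\<close> immediately after
  \<open>S\<close>, and \<open>X S \<omega> > 0\<close> keeps 1/X bounded there, so the clock cannot
  jump over \<open>T\<close>.\<close>

lemma clock_at_clock_inverse:
  assumes rc: "right_cont_path (\<lambda>t. X t \<omega>)"
    and S: "clock_inverse X T \<omega> = ennreal S" "0 \<le> S" "0 < X S \<omega>"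
  shows "clock X S \<omega> = ennreal T"
proof (rule antisym)
  \<comment> \<open>For small \<open>n\<close> the time may be negative, where the clock is
    0.\<close>
  have "clock X (S - 1 / real (Suc n)) \<omega> \<le> ennreal T" for n
  proof (cases "0 \<le> S - 1 / real (Suc n)")
    case True
    then show ?thesis using S by (intro clock_le_if_less_inverse) (auto simp: ennreal_less_iff)
  qed (simp add: clock_less_0)
  then show "clock X S \<omega> \<le> ennreal T"
    by (subst clock_left_SUP[of X \<omega>, OF rc]) (auto intro: SUP_least)
next
  show "ennreal T \<le> clock X S \<omega>"
  proof (rule ennreal_le_epsilon)
    fix e :: real assume e: "0 < e"
    have "\<forall>\<^sub>F u in at_right S. X S \<omega> / 2 < X u \<omega>"
      using right_cont_path_tendsto[OF rc S(2)] S(3) by (intro order_tendstoD) auto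
    then obtain b where b: "b > S" "\<And>u. S < u \<Longrightarrow> u < b \<Longrightarrow> X S \<omega> / 2 < X u \<omega>"
      by (auto simp: eventually_at_right_field)
    \<comment> \<open>The first term keeps \<open>S + v\<close> below \<open>b\<close>, where X >
      X(S)/2 holds; the second makes the clock increase by at most (2 / X(S)) v \<le> e.\<close>
    define v where "v = min ((b - S) / 2) (e * X S \<omega> / 2)"
    have v: "0 < v" "S + v < b" "v \<le> e * X S \<omega> / 2" using b e S by (auto simp: v_def min_def field_simps)
    have "clock (\<lambda>u. X (S + u)) v \<omega> \<le> (\<integral>\<^sup>+u\<in>{0..v}. ennreal (2 / X S \<omega>) \<partial>lborel)"
      unfolding clock_def
    proof (rule nn_integral_mono)
      fix u
      have "inverse (ennreal (X (S + u) \<omega>)) \<le> ennreal (2 / X S \<omega>)" if "0 \<le> u" "u \<le> v"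
      proof -
        have "X S \<omega> / 2 \<le> X (S + u) \<omega>" using b(2)[of "S + u"] v that S by (cases "u = 0") auto
        moreover from this have "inverse (ennreal (X (S + u) \<omega>)) = ennreal (inverse (X (S + u) \<omega>))"
          using S by (intro inverse_ennreal) auto
        ultimately show ?thesis using S by (auto intro!: ennreal_leI simp: field_simps)
      qed
      then show "inverse (ennreal (X (S + u) \<omega>)) * indicator {0..v} u \<le> ennreal (2 / X S \<omega>) * indicator {0..v} u"
        by (auto simp: indicator_def)
    qed
    also have "\<dots> = ennreal (2 / X S \<omega> * v)"
      using v S by (simp add: nn_integral_cmult_indicator ennreal_mult'[symmetric])
    also have "\<dots> \<le> ennreal e" using v S by (intro ennreal_leI) (auto simp: field_simps)
    finally have "clock X (S + v) \<omega> \<le> clock X S \<omega> + ennreal e"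
      using clock_add[of X \<omega>, OF rc S(2), of v] v by (simp add: add_left_mono)
    moreover have "clock_inverse X T \<omega> < ennreal (S + v)" using S v by (simp add: ennreal_less_iff)
    then obtain q where "0 \<le> q" "ennreal q < ennreal (S + v)" "ennreal T < clock X q \<omega>"
      by (auto simp: clock_inverse_less_iff)
    then have "ennreal T \<le> clock X (S + v) \<omega>"
      using clock_mono[of q "S + v" X \<omega>] by (auto simp: ennreal_less_iff)
    ultimately show "ennreal T \<le> clock X S \<omega> + ennreal e" by simp
  qed
qed

lemma INF_ennreal_const_add':
  fixes f :: "'a \<Rightarrow> ennreal"
  shows "(INF i\<in>I. ennreal c + f i) = ennreal c + (INF i\<in>I. f i)"
proof (rule antisym)
  have "(INF i\<in>I. ennreal c + f i) - ennreal c \<le> (INF i\<in>I. f i)"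
  proof (rule INF_greatest)
    fix i assume "i \<in> I"
    then have "(INF i\<in>I. ennreal c + f i) \<le> ennreal c + f i" by (rule INF_lower)
    then show "(INF i\<in>I. ennreal c + f i) - ennreal c \<le> f i" by (simp add: ennreal_minus_le_iff)
  qed
  then show "(INF i\<in>I. ennreal c + f i) \<le> ennreal c + (INF i\<in>I. f i)" by (simp add: ennreal_minus_le_iff)
qed (intro INF_greatest add_left_mono INF_lower; simp)

text \<open>Since A(S) = T, the clock passes T + u at S + v exactly when the restarted clock passes
  \<open>u\<close> at \<open>v\<close>. Hence \<theta>(T + u) is \<open>S\<close> plus the inverse
  of the restarted clock at \<open>u\<close>.\<close>

lemma time_changed_shift:
  assumes rc: "right_cont_path (\<lambda>t. X t \<omega>)"
    and S: "clock_inverse X T \<omega> = ennreal S" "0 \<le> S" "0 < X S \<omega>"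
    and T: "0 \<le> T" and u: "0 \<le> u"
  shows "time_changed X (T + u) \<omega> = time_changed (\<lambda>v. X (S + v)) u \<omega>"
proof -
  note clock_S = clock_at_clock_inverse[of X \<omega>, OF rc S]
  note add = clock_add[of X \<omega>, OF rc S(2), unfolded clock_S]
  have iff: "ennreal (T + u) < clock X (S + v) \<omega> \<longleftrightarrow> ennreal u < clock (\<lambda>v. X (S + v)) v \<omega>" if "0 \<le> v" for v
    using T u by (simp add: add[OF that] ennreal_plus)
  have "{s. 0 \<le> s \<and> clock X s \<omega> > ennreal (T + u)} =
      (\<lambda>v. S + v) ` {v. 0 \<le> v \<and> clock (\<lambda>v. X (S + v)) v \<omega> > ennreal u}" (is "?A = _ ` ?B")
  proof (intro set_eqI iffI)
    fix s assume s: "s \<in> ?A"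
    have "S \<le> s"
    proof (rule ccontr)
      assume "\<not> S \<le> s"
      then have "clock X s \<omega> \<le> ennreal T" using clock_mono[of s S X \<omega>] clock_S by simp
      also have "\<dots> \<le> ennreal (T + u)" using u by (intro ennreal_leI) simp
      finally show False using s leD by blast
    qed
    then show "s \<in> (\<lambda>v. S + v) ` ?B" using s iff[of "s - S"] by (intro image_eqI[of _ _ "s - S"]) auto
  next
    fix s assume "s \<in> (\<lambda>v. S + v) ` ?B"
    then show "s \<in> ?A" using S iff by auto
  qed
  then have "clock_inverse X (T + u) \<omega> = (INF v\<in>?B. ennreal S + ennreal v)"
    unfolding clock_inverse_def using S by (auto simp: image_image intro!: INF_cong)
  also have "\<dots> = ennreal S + clock_inverse (\<lambda>v. X (S + v)) u \<omega>"
    unfolding clock_inverse_def by (rule INF_ennreal_const_add')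
  finally have *: "clock_inverse X (T + u) \<omega> = ennreal S + clock_inverse (\<lambda>v. X (S + v)) u \<omega>" .
  show ?thesis
    unfolding time_changed_def * using S
    by (cases "clock_inverse (\<lambda>v. X (S + v)) u \<omega>") (auto simp: ennreal_plus[symmetric] simp del: ennreal_plus)
qed

section \<open>Path functionals and filtrations\<close>

lemma measurable_sample_path:
  "(\<And>t. 0 \<le> t \<Longrightarrow> Z t \<in> borel_measurable N) \<Longrightarrow> sample_path Z \<in> measurable N path_space"
  unfolding sample_path_def[abs_def] by (intro measurable_restrict) auto

lemma sample_path_in_right_cont_paths:
  "right_cont_path (\<lambda>t. X t \<omega>) \<Longrightarrow> sample_path X \<omega> \<in> space right_cont_paths"
  using sample_path_right_cont[of X \<omega>]
  by (auto simp: right_cont_paths_def space_restrict_space space_PiM sample_path_def)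

text \<open>Reduces statements about the law of the time-changed process to statements about the law
  of \<open>X\<close>. One event \<open>C'\<close> serves all right-continuous processes, so it
  applies to shifted and scaled versions of \<open>X\<close> as well.\<close>

lemma time_changed_set_lift:
  fixes C :: "(real \<Rightarrow> real) set"
  assumes "C \<in> sets path_space"
  obtains C' where "C' \<in> sets path_space"
    "\<And>X (\<omega>::'w). right_cont_path (\<lambda>t. X t \<omega>) \<Longrightarrow>
      sample_path (time_changed X) \<omega> \<in> C \<longleftrightarrow> sample_path X \<omega> \<in> C'"
proof -
  \<comment> \<open>The time change of the coordinate process, a measurable map on the
    right-continuous paths.\<close>
  let ?Y = "time_changed (\<lambda>t f. f t)"
  have Y: "sample_path ?Y \<in> measurable right_cont_paths path_space"
    by (intro measurable_sample_path measurable_time_changed measurable_coord_right_cont_paths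
        space_right_cont_paths)
  have "sample_path ?Y -` C \<inter> space right_cont_paths \<in> sets right_cont_paths"
    using Y assms by (rule measurable_sets)
  from right_cont_paths_set_lift[OF this] obtain C' where C': "C' \<in> sets path_space"
    "\<And>X (\<omega>::'w). right_cont_path (\<lambda>t. X t \<omega>) \<Longrightarrow>
      sample_path X \<omega> \<in> C' \<longleftrightarrow> sample_path X \<omega> \<in> sample_path ?Y -` C \<inter> space right_cont_paths"
    by blast
  have "sample_path ?Y (sample_path X \<omega>) = sample_path (time_changed X) \<omega>" for X and \<omega> :: 'w
    by (simp add: sample_path_def[of ?Y] sample_path_def[of "time_changed X"] time_changed_sample_path)
  with C' show ?thesis
    by (intro that[of C']) (simp_all add: sample_path_in_right_cont_paths)
qed

text \<open>The analogous reduction for the path functional A(\<infinity>).\<close>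

lemma clock_total_set_lift:
  assumes [measurable]: "B \<in> sets borel"
  obtains C where "C \<in> sets path_space"
    "\<And>X (\<omega>::'w). right_cont_path (\<lambda>t. X t \<omega>) \<Longrightarrow> sample_path X \<omega> \<in> C \<longleftrightarrow> clock_total X \<omega> \<in> B"
proof -
  let ?A = "clock_total (\<lambda>t f. f t)"
  have "?A \<in> borel_measurable right_cont_paths"
    by (intro measurable_clock_total measurable_coord_right_cont_paths space_right_cont_paths)
  then have "?A -` B \<inter> space right_cont_paths \<in> sets right_cont_paths"
    by (rule measurable_sets) simp
  from right_cont_paths_set_lift[OF this] obtain C where "C \<in> sets path_space"
    "\<And>X (\<omega>::'w). right_cont_path (\<lambda>t. X t \<omega>) \<Longrightarrow>
      sample_path X \<omega> \<in> C \<longleftrightarrow> sample_path X \<omega> \<in> ?A -` B \<inter> space right_cont_paths"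
    by blast
  then show ?thesis
    by (intro that[of C]) (simp_all add: sample_path_in_right_cont_paths clock_total_sample_path)
qed

section \<open>Natural filtrations and their right limits\<close>

lemma space_natural_filtration [simp]: "space (natural_filtration M X t) = space M"
  by (simp add: natural_filtration_def)

lemma measurable_natural_filtration:
  assumes "0 \<le> s" "ennreal s \<le> t"
  shows "X s \<in> borel_measurable (natural_filtration M X t)"
proof -
  let ?I = "{s. 0 \<le> s \<and> ennreal s \<le> t}"
  have "(\<lambda>\<omega>. \<lambda>s\<in>?I. X s \<omega>) \<in> measurable (natural_filtration M X t) (PiM ?I (\<lambda>_. borel))"
    unfolding natural_filtration_def by (rule measurable_vimage_algebra1) (auto simp: space_PiM)
  from measurable_compose[OF this measurable_component_singleton[of s]] assms show ?thesis
    by simp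
qed

lemma sets_natural_filtration_subset:
  assumes "space N = space M" "\<And>s. 0 \<le> s \<Longrightarrow> ennreal s \<le> t \<Longrightarrow> X s \<in> borel_measurable N"
  shows "sets (natural_filtration M X t) \<subseteq> sets N"
  unfolding natural_filtration_def
  by (intro sets_image_in_sets measurable_restrict assms) auto

lemma natural_filtration_mono:
  "s \<le> t \<Longrightarrow> sets (natural_filtration M X s) \<subseteq> sets (natural_filtration M X t)"
  by (intro sets_natural_filtration_subset measurable_natural_filtration) auto

text \<open>An intersection of sigma-algebras on \<open>space M\<close> is a sigma-algebra, so
  \<open>sigma\<close> in the definition adds no sets.\<close>

lemma
  shows space_natural_filtration_right: "space (natural_filtration_right M X t) = space M"
    and sets_natural_filtration_right:
      "sets (natural_filtration_right M X t) = (\<Inter>\<epsilon>\<in>{0<..}. sets (natural_filtration M X (t + \<epsilon>)))"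
proof -
  let ?S = "\<Inter>\<epsilon>\<in>{0<..}. sets (natural_filtration M X (t + \<epsilon>))"
  have sub: "?S \<subseteq> sets (natural_filtration M X (t + \<epsilon>))" if "0 < \<epsilon>" for \<epsilon> using that by auto
  have Pow: "?S \<subseteq> Pow (space M)"
    using sub[of 1] sets.space_closed[of "natural_filtration M X (t + 1)"] by auto
  show "space (natural_filtration_right M X t) = space M"
    unfolding natural_filtration_right_def by (rule space_measure_of[OF Pow])
  have "sigma_sets (space M) ?S \<subseteq> sets (natural_filtration M X (t + \<epsilon>))" if "0 < \<epsilon>" for \<epsilon>
    using sets.sigma_sets_subset[OF sub[OF that]] by simp
  then show "sets (natural_filtration_right M X t) = ?S"
    unfolding natural_filtration_right_def sets_measure_of[OF Pow] by auto
qed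

text \<open>The gap between \<open>s\<close> and \<open>t\<close> is itself one of the \<epsilon>
  over which the right limit intersects; t = \<infinity> is included.\<close>

lemma natural_filtration_right_subset:
  assumes "s < t"
  shows "sets (natural_filtration_right M X s) \<subseteq> sets (natural_filtration M X t)"
proof -
  obtain \<epsilon> where "t = s + \<epsilon>" using less_imp_le[OF assms] by (auto simp: le_iff_add)
  moreover from this assms have "0 < \<epsilon>" by (cases "\<epsilon> = 0") (auto simp: zero_less_iff_neq_zero)
  ultimately show ?thesis unfolding sets_natural_filtration_right by auto
qed

lemma filtration_natural_filtration_right: "filtration (space M) (natural_filtration_right M X)"
proof
  fix i j :: ennreal assume "i \<le> j"
  then show "sets (natural_filtration_right M X i) \<subseteq> sets (natural_filtration_right M X j)"
    unfolding sets_natural_filtration_right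
    by (intro INT_anti_mono[OF order_refl] natural_filtration_mono add_right_mono)
qed (simp add: space_natural_filtration_right)

text \<open>If some restarted total clock is finite, the remaining clock tends to 0 and is
  eventually at most 1; otherwise all of them are infinite. This is the pathwise half of the
  contradiction that excludes a finite total clock.\<close>

lemma clock_total_tail:
  assumes rc: "right_cont_path (\<lambda>t. X t \<omega>)"
    and t: "filterlim t at_top sequentially" "\<And>n. 0 \<le> t n"
  shows "\<forall>\<^sub>F n in sequentially. \<not> (1 < clock_total (\<lambda>u. X (t n + u)) \<omega> \<and> clock_total (\<lambda>u. X (t n + u)) \<omega> < \<infinity>)"
proof (cases "\<exists>n. clock_total (\<lambda>u. X (t n + u)) \<omega> < \<infinity>")
  case True
  then obtain n where n: "clock_total (\<lambda>u. X (t n + u)) \<omega> < \<infinity>" by auto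
  define W where "W = (\<lambda>u. X (t n + u))"
  have rcW: "right_cont_path (\<lambda>u. W u \<omega>)" unfolding W_def by (intro right_cont_path_shift rc t)
  obtain T where T: "clock_total W \<omega> = ennreal T" "0 < T"
    using n clock_total_pos[of W \<omega>, OF rcW] by (cases "clock_total W \<omega>") (auto simp: W_def)
  have "ennreal (T - 1) < (SUP m. clock W (real m) \<omega>)"
    using T clock_total_SUP[of W \<omega>, OF rcW] by (simp add: ennreal_lessI)
  then obtain m where m: "ennreal (T - 1) < clock W (real m) \<omega>" by (auto simp: less_SUP_iff)
  \<comment> \<open>For T < 1 the number \<open>T - 1\<close> is negative and \<open>ennreal\<close>
    sends it to 0.\<close>
  have "ennreal T \<le> ennreal (T - 1) + 1"
  proof (cases "1 \<le> T")
    case True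
    then have "ennreal (T - 1) + ennreal 1 = ennreal T" by (subst ennreal_plus[symmetric]) auto
    then show ?thesis by simp
  next
    case False
    then show ?thesis using ennreal_leI[of T 1] by (simp add: ennreal_neg)
  qed
  also have "\<dots> \<le> clock W (real m) \<omega> + 1" using m by (intro add_right_mono) auto
  finally have Tm: "ennreal T \<le> clock W (real m) \<omega> + 1" .
  have "\<forall>\<^sub>F k in sequentially. t n + real m \<le> t k"
    using t(1) by (simp add: filterlim_at_top)
  then show ?thesis
  proof eventually_elim
    fix k assume k: "t n + real m \<le> t k"
    let ?v = "t k - t n"
    have v: "0 \<le> ?v" "real m \<le> ?v" using k by auto
    have "clock W ?v \<omega> + clock_total (\<lambda>u. X (t k + u)) \<omega> = ennreal T"
      using clock_total_add[of W \<omega> ?v, OF rcW v(1)] T by (simp add: W_def add.assoc[symmetric])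
    also have "\<dots> \<le> clock W ?v \<omega> + 1"
      using Tm clock_mono[OF v(2), of W \<omega>] by (meson add_right_mono order_trans)
    \<comment> \<open>Cancellation is legitimate because the clock of \<open>W\<close> is bounded by
      the finite \<open>T\<close>.\<close>
    finally have "clock_total (\<lambda>u. X (t k + u)) \<omega> \<le> 1"
      using clock_le_total[of W ?v \<omega>] T by (auto simp: ennreal_add_left_cancel_le top_unique)
    then show "\<not> (1 < clock_total (\<lambda>u. X (t k + u)) \<omega> \<and> clock_total (\<lambda>u. X (t k + u)) \<omega> < \<infinity>)"
      by auto
  qed
qed (auto intro: always_eventually)

section \<open>Self-similarity and the Markov property of the total clock\<close>

context pssMp
begin

lemma space_Q: "0 < x \<Longrightarrow> space (Q x) = space M"
  by (rule sets_eq_imp_space_eq) (rule sets_Q)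

lemma measurable_shifted: "0 \<le> s \<Longrightarrow> 0 \<le> t \<Longrightarrow> X (s + t) \<in> borel_measurable M"
  by (intro measurable_X) auto

lemma right_cont_shifted: "0 \<le> s \<Longrightarrow> \<omega> \<in> space M \<Longrightarrow> right_cont_path (\<lambda>t. X (s + t) \<omega>)"
  using right_cont_path_shift[OF right_cont] .

lemma measurable_clock_total_X [measurable]: "clock_total X \<in> borel_measurable M"
  by (intro measurable_clock_total measurable_X right_cont)

lemma measurable_clock_total_shifted: "0 \<le> s \<Longrightarrow> clock_total (\<lambda>t. X (s + t)) \<in> borel_measurable M"
  by (intro measurable_clock_total measurable_shifted right_cont_shifted)

lemma right_cont_scaled:
  assumes "0 < k" "\<omega> \<in> space M" "0 < c"
  shows "right_cont_path (\<lambda>t. k * X (c * t) \<omega>)"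
  unfolding right_cont_path_def continuous_within
proof (intro allI impI tendsto_mult tendsto_const)
  fix t :: real assume "0 \<le> t"
  have "filterlim (\<lambda>u. c * u) (at_right (c * t)) (at_right t)"
    unfolding filterlim_at using assms by (auto intro!: tendsto_intros simp: eventually_at_filter)
  from filterlim_compose[OF right_cont_path_tendsto[OF right_cont[OF assms(2)]] this]
  show "((\<lambda>u. X (c * u) \<omega>) \<longlongrightarrow> X (c * t) \<omega>) (at_right t)"
    using \<open>0 \<le> t\<close> assms by simp
qed

lemma measurable_scaled: "0 < c \<Longrightarrow> 0 \<le> t \<Longrightarrow> (\<lambda>\<omega>. k * X (c * t) \<omega>) \<in> borel_measurable M"
  by (intro borel_measurable_times measurable_X) auto

lemma emeasure_process_law:
  assumes "0 < x" "\<And>t. 0 \<le> t \<Longrightarrow> Z t \<in> borel_measurable M" "C \<in> sets path_space"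
  shows "emeasure (process_law (Q x) Z) C = emeasure (Q x) {\<omega>\<in>space M. sample_path Z \<omega> \<in> C}"
proof -
  have "sample_path Z \<in> measurable (Q x) path_space"
    using assms by (simp add: measurable_sample_path cong: measurable_cong_sets[OF sets_Q refl])
  with assms show ?thesis
    unfolding process_law_def
    by (subst emeasure_distr) (auto simp: space_Q intro!: arg_cong[where f="emeasure (Q x)"])
qed

lemma self_similar_event:
  assumes "0 < x" "0 < k" "C \<in> sets path_space"
  shows "emeasure (Q (k * x)) {\<omega>\<in>space M. sample_path X \<omega> \<in> C} =
    emeasure (Q x) {\<omega>\<in>space M. sample_path (\<lambda>t \<omega>. k * X (k powr (-\<alpha>) * t) \<omega>) \<omega> \<in> C}"
  using self_similar[OF assms(1,2)] assms
  by (simp add: emeasure_process_law[symmetric] measurable_X measurable_scaled)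

text \<open>Self-similarity with factor \<open>x\<close> from the starting point 1: scaling
  multiplies the total clock by \<open>inverse (x * x powr (-\<alpha>))\<close>, which is
  \<open>x powr (\<alpha> - 1)\<close>.\<close>

lemma clock_total_self_similar:
  assumes "0 < x" and B: "B \<in> sets borel"
  shows "emeasure (Q x) {\<omega>\<in>space M. clock_total X \<omega> \<in> B} =
    emeasure (Q 1) {\<omega>\<in>space M. ennreal (x powr (\<alpha> - 1)) * clock_total X \<omega> \<in> B}"
proof -
  obtain C where C: "C \<in> sets path_space"
    "\<And>X (\<omega>::'w). right_cont_path (\<lambda>t. X t \<omega>) \<Longrightarrow> sample_path X \<omega> \<in> C \<longleftrightarrow> clock_total X \<omega> \<in> B"
    using clock_total_set_lift[OF B] by blast
  have inv: "inverse (x * x powr (-\<alpha>)) = x powr (\<alpha> - 1)"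
    using assms by (simp add: powr_minus powr_diff field_simps)
  have "emeasure (Q x) {\<omega>\<in>space M. clock_total X \<omega> \<in> B} =
      emeasure (Q (x * 1)) {\<omega>\<in>space M. sample_path X \<omega> \<in> C}"
    using C(2)[of X, OF right_cont] by (intro arg_cong2[where f=emeasure]) auto
  also have "\<dots> = emeasure (Q 1) {\<omega>\<in>space M. sample_path (\<lambda>t \<omega>. x * X (x powr (-\<alpha>) * t) \<omega>) \<omega> \<in> C}"
    using assms C by (intro self_similar_event) auto
  also have "\<dots> = emeasure (Q 1) {\<omega>\<in>space M. ennreal (x powr (\<alpha> - 1)) * clock_total X \<omega> \<in> B}"
  proof (intro arg_cong2[where f=emeasure] refl Collect_cong conj_cong)
    fix \<omega> assume \<omega>: "\<omega> \<in> space M"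
    show "sample_path (\<lambda>t \<omega>. x * X (x powr (-\<alpha>) * t) \<omega>) \<omega> \<in> C \<longleftrightarrow>
        ennreal (x powr (\<alpha> - 1)) * clock_total X \<omega> \<in> B"
    proof -
      have "clock_total (\<lambda>t \<omega>. x * X (x powr (-\<alpha>) * t) \<omega>) \<omega> = ennreal (x powr (\<alpha> - 1)) * clock_total X \<omega>"
        using clock_scale(2)[of X \<omega> x "x powr (-\<alpha>)", OF right_cont[OF \<omega>]] assms unfolding inv by simp
      moreover have "right_cont_path (\<lambda>t. x * X (x powr (-\<alpha>) * t) \<omega>)"
        using assms \<omega> by (intro right_cont_scaled) auto
      ultimately show ?thesis by (simp add: C(2))
    qed
  qed
  finally show ?thesis .
qed

text \<open>The strong Markov property at the constant time \<open>t\<close>, with the whole space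
  as past event.\<close>

lemma clock_total_markov:
  assumes "0 < x" "0 \<le> t" and B: "B \<in> sets borel"
  shows "emeasure (Q x) {\<omega>\<in>space M. 0 < X t \<omega> \<and> clock_total (\<lambda>u. X (t + u)) \<omega> \<in> B} =
    (\<integral>\<^sup>+\<omega>\<in>{\<omega>\<in>space M. 0 < X t \<omega>}. emeasure (Q (X t \<omega>)) {\<omega>'\<in>space M. clock_total X \<omega>' \<in> B} \<partial>Q x)"
proof -
  obtain C where C: "C \<in> sets path_space"
    "\<And>X (\<omega>::'w). right_cont_path (\<lambda>t. X t \<omega>) \<Longrightarrow> sample_path X \<omega> \<in> C \<longleftrightarrow> clock_total X \<omega> \<in> B"
    using clock_total_set_lift[OF B] by blast
  interpret F: filtration "space M" "natural_filtration_right M X" by (rule filtration_natural_filtration_right)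
  have "space M \<in> sets (F.pre_sigma (\<lambda>_. ennreal t))"
    using sets.top[of "F.pre_sigma (\<lambda>_. ennreal t)"] by (simp add: F.space_pre_sigma)
  from strong_markov[OF \<open>0 < x\<close> stopping_time_const this C(1)] \<open>0 \<le> t\<close>
  show ?thesis
    using C(2)[of X, OF right_cont] C(2)[of "\<lambda>u. X (t + u)", OF right_cont_shifted[OF \<open>0 \<le> t\<close>]]
    by (simp cong: conj_cong)
qed

end

section \<open>The total clock is infinite\<close>

lemma emeasure_lborel_atLeast: "emeasure lborel {a::real..} = \<infinity>"
proof (rule ccontr)
  assume "emeasure lborel {a..} \<noteq> \<infinity>"
  then obtain r where r: "emeasure lborel {a..} = ennreal r" "0 \<le> r"
    by (cases "emeasure lborel {a..}") auto
  have "emeasure lborel {a..a + (r + 1)} \<le> emeasure lborel {a..}" by (intro emeasure_mono) auto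
  with r show False by simp
qed

context pssMp
begin

text \<open>By contradiction, with the probabilities \<delta> of c < A(\<infinity>) < \<infinity>
  and \<open>p\<close> of A(\<infinity>) \<le> L both positive. From positions above
  \<open>K\<close> the restarted clock lies in (1,\<infinity>) with probability at least \<delta>,
  so such positions become unlikely. Hence \<open>X\<close> would be below \<open>K\<close> with
  probability at least p/2 on A(\<infinity>) \<le> L at all late times, although such paths spend at
  most time K L there.\<close>

lemma AE_clock_total_infinite_1:
  assumes "1 < \<alpha>"
  shows "AE \<omega> in Q 1. clock_total X \<omega> = \<infinity>"
proof -
  interpret P: prob_space "Q 1" by (rule prob_space_Q) simp
  have sets1: "sets (Q 1) = sets M" and space1: "space (Q 1) = space M"
    by (simp_all add: sets_Q space_Q)
  note [measurable_cong] = sets1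
  have [measurable]: "X t \<in> borel_measurable M" if "0 \<le> t" for t by (rule measurable_X[OF that])
  have [measurable]: "clock_total (\<lambda>u. X (t + u)) \<in> borel_measurable M" if "0 \<le> t" for t
    by (rule measurable_clock_total_shifted[OF that])
  let ?A = "clock_total X"
  have "P.prob {\<omega>\<in>space M. ?A \<omega> < \<infinity>} = 0"
  proof (rule ccontr)
    assume "P.prob {\<omega>\<in>space M. ?A \<omega> < \<infinity>} \<noteq> 0"
    then have pos: "emeasure (Q 1) {\<omega>\<in>space M. ?A \<omega> < \<infinity>} \<noteq> 0" by (simp add: P.emeasure_eq_measure)

    \<comment> \<open>The total clock is positive, so these events exhaust the event that it is
      finite and one of them has positive probability.\<close>
    have "\<exists>n. P.prob {\<omega>\<in>space M. inverse (real (Suc n)) < ?A \<omega> \<and> ?A \<omega> < \<infinity>} \<noteq> 0"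
    proof (rule ccontr)
      assume "\<nexists>n. P.prob {\<omega>\<in>space M. inverse (real (Suc n)) < ?A \<omega> \<and> ?A \<omega> < \<infinity>} \<noteq> 0"
      then have "(\<Union>n. {\<omega>\<in>space M. inverse (real (Suc n)) < ?A \<omega> \<and> ?A \<omega> < \<infinity>}) \<in> null_sets (Q 1)"
        by (intro null_sets_UN) (auto simp: null_sets_def P.emeasure_eq_measure)
      also have "(\<Union>n. {\<omega>\<in>space M. inverse (real (Suc n)) < ?A \<omega> \<and> ?A \<omega> < \<infinity>}) = {\<omega>\<in>space M. ?A \<omega> < \<infinity>}"
      proof safe
        fix \<omega> assume \<omega>: "\<omega> \<in> space M" "?A \<omega> < \<infinity>"
        then obtain a where a: "?A \<omega> = ennreal a" "0 < a"
          using clock_total_pos[of X \<omega>, OF right_cont] by (cases "?A \<omega>") auto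
        then obtain n where "inverse (real (Suc n)) < a" using reals_Archimedean by auto
        then show "\<omega> \<in> (\<Union>n. {\<omega>\<in>space M. inverse (real (Suc n)) < ?A \<omega> \<and> ?A \<omega> < \<infinity>})"
          using \<omega> a by (auto intro!: exI[of _ n] ennreal_lessI simp del: of_nat_Suc)
      qed
      finally show False using pos by auto
    qed
    then obtain c where c: "0 < c" "P.prob {\<omega>\<in>space M. ennreal c < ?A \<omega> \<and> ?A \<omega> < \<infinity>} \<noteq> 0"
      by (metis inverse_positive_iff_positive of_nat_0_less_iff zero_less_Suc)
    define \<delta> where "\<delta> = P.prob {\<omega>\<in>space M. ennreal c < ?A \<omega> \<and> ?A \<omega> < \<infinity>}"
    have \<delta>: "0 < \<delta>" using c by (simp add: \<delta>_def zero_less_measure_iff)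

    have "\<exists>n. P.prob {\<omega>\<in>space M. ?A \<omega> \<le> real n} \<noteq> 0"
    proof (rule ccontr)
      assume "\<nexists>n. P.prob {\<omega>\<in>space M. ?A \<omega> \<le> real n} \<noteq> 0"
      then have "(\<Union>n. {\<omega>\<in>space M. ?A \<omega> \<le> real n}) \<in> null_sets (Q 1)"
        by (intro null_sets_UN) (auto simp: null_sets_def P.emeasure_eq_measure)
      also have "(\<Union>n. {\<omega>\<in>space M. ?A \<omega> \<le> real n}) = {\<omega>\<in>space M. ?A \<omega> < \<infinity>}"
      proof safe
        fix \<omega> assume \<omega>: "\<omega> \<in> space M" "?A \<omega> < \<infinity>"
        then obtain a where a: "?A \<omega> = ennreal a" by (cases "?A \<omega>") auto
        obtain n where "a \<le> real n" using real_arch_simple by blast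
        then show "\<omega> \<in> (\<Union>n. {\<omega>\<in>space M. ?A \<omega> \<le> real n})" using \<omega> a by (auto intro!: ennreal_leI)
      qed (auto intro: le_less_trans)
      finally show False using pos by auto
    qed
    then obtain L :: nat where L: "P.prob {\<omega>\<in>space M. ?A \<omega> \<le> real L} \<noteq> 0" by auto
    define p where "p = P.prob {\<omega>\<in>space M. ?A \<omega> \<le> real L}"
    have p: "0 < p" using L by (simp add: p_def zero_less_measure_iff)

    \<comment> \<open>The solution of \<open>K powr (\<alpha> - 1) * c = 1\<close>: started above
      \<open>K\<close>, the scaled clock exceeds 1 once the unscaled one exceeds \<open>c\<close>.
      The exponent exists because \<alpha> > 1.\<close>
    define K where "K = c powr (- 1 / (\<alpha> - 1))"
    have K: "0 < K" "K powr (\<alpha> - 1) * c = 1"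
    proof -
      have "- 1 / (\<alpha> - 1) * (\<alpha> - 1) = - 1" using assms by (simp add: field_simps)
      then have "K powr (\<alpha> - 1) = c powr (- 1)" unfolding K_def powr_powr by simp
      then show "K powr (\<alpha> - 1) * c = 1" using c by (simp add: powr_minus)
    qed (use c in \<open>simp add: K_def\<close>)

    \<comment> \<open>Markov property at \<open>t\<close>, then self-similarity: given X(t) \<ge> K
      the restarted clock is distributed like \<open>X t \<omega> powr (\<alpha> - 1)\<close> times
      A(\<infinity>) under \<open>Q 1\<close>, and that factor is at least 1/c.\<close>
    have lower: "ennreal (\<delta> * P.prob {\<omega>\<in>space M. K \<le> X t \<omega>}) \<le>
        emeasure (Q 1) {\<omega>\<in>space M. 1 < clock_total (\<lambda>u. X (t + u)) \<omega> \<and> clock_total (\<lambda>u. X (t + u)) \<omega> < \<infinity>}"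
      if t: "0 \<le> t" for t
    proof -
      let ?B = "{1<..<\<infinity>} :: ennreal set"
      have "ennreal (\<delta> * P.prob {\<omega>\<in>space M. K \<le> X t \<omega>}) =
          (\<integral>\<^sup>+\<omega>\<in>{\<omega>\<in>space M. K \<le> X t \<omega>}. ennreal \<delta> \<partial>Q 1)"
        using t \<delta> by (subst nn_integral_cmult_indicator) (auto simp: P.emeasure_eq_measure ennreal_mult')
      also have "\<dots> \<le> (\<integral>\<^sup>+\<omega>\<in>{\<omega>\<in>space M. 0 < X t \<omega>}. emeasure (Q (X t \<omega>)) {\<omega>'\<in>space M. ?A \<omega>' \<in> ?B} \<partial>Q 1)"
      proof (rule nn_integral_mono)
        fix \<omega>
        have "ennreal \<delta> \<le> emeasure (Q (X t \<omega>)) {\<omega>'\<in>space M. ?A \<omega>' \<in> ?B}" if "K \<le> X t \<omega>"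
        proof -
          let ?y = "X t \<omega> powr (\<alpha> - 1)"
          have "K powr (\<alpha> - 1) \<le> ?y" using that K assms by (intro powr_mono2) auto
          then have yc: "1 \<le> ?y * c" using K c by (metis mult_right_mono less_imp_le)
          have y: "0 < ?y" using that K by simp
          have "ennreal \<delta> = emeasure (Q 1) {\<omega>\<in>space M. ennreal c < ?A \<omega> \<and> ?A \<omega> < \<infinity>}"
            by (simp add: \<delta>_def P.emeasure_eq_measure)
          also have "\<dots> \<le> emeasure (Q 1) {\<omega>'\<in>space M. ennreal ?y * ?A \<omega>' \<in> ?B}"
          proof (rule emeasure_mono)
            have "ennreal ?y * a \<in> ?B" if "ennreal c < a" "a < \<infinity>" for a
            proof -
              have "1 \<le> ennreal ?y * ennreal c" using yc y by (simp add: ennreal_mult'[symmetric])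
              also have "\<dots> < ennreal ?y * a" using that y by (simp add: ennreal_mult_less_cancel_pos)
              finally show ?thesis using that by (simp add: ennreal_mult_less_top)
            qed
            then show "{\<omega>\<in>space M. ennreal c < ?A \<omega> \<and> ?A \<omega> < \<infinity>} \<subseteq> {\<omega>'\<in>space M. ennreal ?y * ?A \<omega>' \<in> ?B}"
              by auto
          qed measurable
          also have "\<dots> = emeasure (Q (X t \<omega>)) {\<omega>'\<in>space M. ?A \<omega>' \<in> ?B}"
            using that K by (intro clock_total_self_similar[symmetric]) auto
          finally show ?thesis .
        qed
        then show "ennreal \<delta> * indicator {\<omega>\<in>space M. K \<le> X t \<omega>} \<omega> \<le>
          emeasure (Q (X t \<omega>)) {\<omega>'\<in>space M. ?A \<omega>' \<in> ?B} * indicator {\<omega>\<in>space M. 0 < X t \<omega>} \<omega>"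
          using K by (auto simp: indicator_def)
      qed
      also have "\<dots> = emeasure (Q 1) {\<omega>\<in>space M. 0 < X t \<omega> \<and> clock_total (\<lambda>u. X (t + u)) \<omega> \<in> ?B}"
        by (rule clock_total_markov[symmetric]) (auto simp: t)
      also have "\<dots> \<le> emeasure (Q 1) {\<omega>\<in>space M. 1 < clock_total (\<lambda>u. X (t + u)) \<omega> \<and> clock_total (\<lambda>u. X (t + u)) \<omega> < \<infinity>}"
        using t by (intro emeasure_mono) auto
      finally show ?thesis .
    qed

    \<comment> \<open>Otherwise \<open>lower\<close> keeps the probability of a restarted clock in
      (1,\<infinity>) above \<delta> p/2 along times tending to infinity, whereas that probability
      tends to 0 by the pathwise tail statement and dominated convergence.\<close>
    have "\<exists>t0\<ge>0. \<forall>t\<ge>t0. P.prob {\<omega>\<in>space M. K \<le> X t \<omega>} \<le> p / 2"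
    proof (rule ccontr)
      assume "\<not> ?thesis"
      then have "\<forall>n. \<exists>t\<ge>real n. p / 2 < P.prob {\<omega>\<in>space M. K \<le> X t \<omega>}"
        by (metis not_le of_nat_0_le_iff)
      then obtain t where t: "\<And>n. real n \<le> t n" "\<And>n. p / 2 < P.prob {\<omega>\<in>space M. K \<le> X (t n) \<omega>}"
        by metis
      have t0: "0 \<le> t n" for n using t(1)[of n] by (meson of_nat_0_le_iff order_trans)
      have t_top: "filterlim t at_top sequentially"
        by (rule filterlim_at_top_mono[OF filterlim_real_sequentially]) (simp add: t)
      let ?S = "\<lambda>n. {\<omega>\<in>space M. 1 < clock_total (\<lambda>u. X (t n + u)) \<omega> \<and> clock_total (\<lambda>u. X (t n + u)) \<omega> < \<infinity>}"
      have "(\<lambda>n. \<integral>\<^sup>+\<omega>. indicator (?S n) \<omega> \<partial>Q 1) \<longlonglongrightarrow> (\<integral>\<^sup>+\<omega>. 0 \<partial>Q 1)"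
      proof (rule nn_integral_dominated_convergence[where w="\<lambda>_. 1"])
        show "AE \<omega> in Q 1. (\<lambda>n. indicator (?S n) \<omega>) \<longlonglongrightarrow> (0 :: ennreal)"
        proof (rule AE_I2, rule tendsto_eventually)
          fix \<omega> assume "\<omega> \<in> space (Q 1)"
          then have "\<omega> \<in> space M" by (simp add: space1)
          from clock_total_tail[of X \<omega> t, OF right_cont[OF this] t_top t0]
          show "\<forall>\<^sub>F n in sequentially. indicator (?S n) \<omega> = (0 :: ennreal)"
            by eventually_elim auto
        qed
      qed (use t0 P.emeasure_space_1 in \<open>auto simp: indicator_def\<close>)
      then have "(\<lambda>n. emeasure (Q 1) (?S n)) \<longlonglongrightarrow> 0" using t0 by simp
      then have "\<forall>\<^sub>F n in sequentially. emeasure (Q 1) (?S n) < ennreal (\<delta> * (p / 2))"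
        using \<delta> p by (intro order_tendstoD) auto
      then obtain n where "emeasure (Q 1) (?S n) < ennreal (\<delta> * (p / 2))"
        by (auto simp: eventually_sequentially)
      also have "\<dots> \<le> ennreal (\<delta> * P.prob {\<omega>\<in>space M. K \<le> X (t n) \<omega>})"
        using t(2)[of n] \<delta> by (intro ennreal_leI mult_left_mono) auto
      finally show False using lower[OF t0[of n]] by simp
    qed
    then obtain t0 where t0: "0 \<le> t0" "\<And>t. t0 \<le> t \<Longrightarrow> P.prob {\<omega>\<in>space M. K \<le> X t \<omega>} \<le> p / 2"
      by blast

    \<comment> \<open>At late times this event has probability at least p - p/2 = p/2.\<close>
    let ?E = "\<lambda>s \<omega>. ?A \<omega> \<le> ennreal (real L) \<and> X (max 0 s) \<omega> < K"
    have half: "ennreal (p / 2) * indicator {t0..} s \<le>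
        (\<integral>\<^sup>+\<omega>. indicator {\<omega>\<in>space M. ?E s \<omega>} \<omega> * indicator {0..} s \<partial>Q 1)" for s
    proof (cases "t0 \<le> s")
      case True
      then have s: "0 \<le> s" using t0 by simp
      have "p \<le> P.prob ({\<omega>\<in>space M. ?E s \<omega>} \<union> {\<omega>\<in>space M. K \<le> X s \<omega>})"
        unfolding p_def using s by (intro P.finite_measure_mono) auto
      also have "\<dots> \<le> P.prob {\<omega>\<in>space M. ?E s \<omega>} + P.prob {\<omega>\<in>space M. K \<le> X s \<omega>}"
        using s by (intro measure_Un_le) auto
      finally have "p / 2 \<le> P.prob {\<omega>\<in>space M. ?E s \<omega>}" using t0(2)[OF True] by simp
      then have "ennreal (p / 2) \<le> emeasure (Q 1) {\<omega>\<in>space M. ?E s \<omega>}"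
        unfolding P.emeasure_eq_measure by (rule ennreal_leI)
      then show ?thesis using s True by simp
    qed simp
    have joint: "(\<lambda>(\<omega>, t). X (max 0 t) \<omega>) \<in> borel_measurable (M \<Otimes>\<^sub>M lborel)"
      by (rule measurable_swapped_process[OF measurable_X right_cont])
    note [measurable] = joint
    interpret pair_sigma_finite lborel "Q 1" ..
    have joint': "(\<lambda>(s, \<omega>). X (max 0 s) \<omega>) \<in> borel_measurable (lborel \<Otimes>\<^sub>M Q 1)"
      using measurable_right_cont_process[OF measurable_X right_cont]
      by (simp cong: measurable_cong_sets[OF sets_pair_measure_cong[OF sets_lborel sets1] refl])
    note [measurable] = joint'
    \<comment> \<open>The expected time spent below \<open>K\<close> on A(\<infinity>) \<le> L,
      computed in two orders: infinite when integrated over \<omega> first, at most K L when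
      integrated over time first.\<close>
    have "\<infinity> = (\<integral>\<^sup>+s. ennreal (p / 2) * indicator {t0..} s \<partial>lborel)"
      using p by (simp add: nn_integral_cmult_indicator emeasure_lborel_atLeast ennreal_mult_top)
    also have "\<dots> \<le> (\<integral>\<^sup>+s. \<integral>\<^sup>+\<omega>. indicator {\<omega>\<in>space M. ?E s \<omega>} \<omega> * indicator {0..} s \<partial>Q 1 \<partial>lborel)"
      by (intro nn_integral_mono half)
    also have "\<dots> = (\<integral>\<^sup>+\<omega>. \<integral>\<^sup>+s. indicator {\<omega>\<in>space M. ?E s \<omega>} \<omega> * indicator {0..} s \<partial>lborel \<partial>Q 1)"
    proof (rule Fubini'[symmetric])
      have "(\<lambda>(s, \<omega>). (if ?E s \<omega> then 1 else 0) * indicator {0..} s :: ennreal) \<in> borel_measurable (lborel \<Otimes>\<^sub>M Q 1)"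
        by measurable
      then show "(\<lambda>(s, \<omega>). indicator {\<omega>\<in>space M. ?E s \<omega>} \<omega> * indicator {0..} s :: ennreal) \<in> borel_measurable (lborel \<Otimes>\<^sub>M Q 1)"
        by (rule measurable_cong[THEN iffD1, rotated]) (auto simp: space_pair_measure space1 indicator_def)
    qed
    also have "\<dots> \<le> (\<integral>\<^sup>+\<omega>. ennreal (K * real L) \<partial>Q 1)"
    proof (rule nn_integral_mono)
      fix \<omega> assume "\<omega> \<in> space (Q 1)"
      then have \<omega>: "\<omega> \<in> space M" by (simp add: space1)
      note [measurable] = measurable_right_cont_path[OF right_cont[OF \<omega>]]
      show "(\<integral>\<^sup>+s. indicator {\<omega>\<in>space M. ?E s \<omega>} \<omega> * indicator {0..} s \<partial>lborel) \<le> ennreal (K * real L)"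
      proof (cases "?A \<omega> \<le> ennreal (real L)")
        case True
        \<comment> \<open>Below \<open>K\<close> one has 1 \<le> K / X, also at X = 0 where the
          inverse is \<infinity>, so the time spent there is bounded by \<open>K\<close> times the
          clock.\<close>
        have "indicator {\<omega>\<in>space M. ?E s \<omega>} \<omega> * indicator {0..} s \<le>
            ennreal K * (inverse (ennreal (X (max 0 s) \<omega>)) * indicator {0..} s)" for s
        proof (cases "X (max 0 s) \<omega> < K \<and> 0 \<le> s")
          case True
          then have sK: "0 \<le> s" "X s \<omega> < K" by (auto simp: max_absorb2)
          have "1 \<le> ennreal K * inverse (ennreal (X (max 0 s) \<omega>))"
          proof (cases "0 < X (max 0 s) \<omega>")
            case pos: True
            then show ?thesis using sK K
              by (simp add: inverse_ennreal ennreal_mult'[symmetric] field_simps)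
          next
            case False
            then show ?thesis using K by (simp add: ennreal_neg ennreal_mult_top)
          qed
          then show ?thesis by (auto simp: indicator_def)
        qed auto
        then have "(\<integral>\<^sup>+s. indicator {\<omega>\<in>space M. ?E s \<omega>} \<omega> * indicator {0..} s \<partial>lborel) \<le>
          (\<integral>\<^sup>+s. ennreal K * (inverse (ennreal (X (max 0 s) \<omega>)) * indicator {0..} s) \<partial>lborel)"
          by (intro nn_integral_mono)
        also have "\<dots> = ennreal K * ?A \<omega>"
          by (subst nn_integral_cmult) (auto simp: clock_total_max0)
        also have "\<dots> \<le> ennreal K * ennreal (real L)" using True by (intro mult_left_mono) auto
        finally show ?thesis using K by (simp add: ennreal_mult'')
      qed simp
    qed
    also have "\<dots> < \<infinity>" by (simp add: P.emeasure_space_1 ennreal_mult_less_top)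
    finally show False by simp
  qed
  then have "{\<omega>\<in>space M. ?A \<omega> < \<infinity>} \<in> null_sets (Q 1)"
    by (simp add: null_sets_def P.emeasure_eq_measure)
  then show ?thesis
    by (rule AE_I') (auto simp: space1 less_top)
qed

text \<open>Under \<open>Q x\<close> the total clock is that under \<open>Q 1\<close> times a finite
  positive factor, which preserves finiteness.\<close>

lemma AE_clock_total_infinite:
  assumes "1 < \<alpha>" "0 < x"
  shows "AE \<omega> in Q x. clock_total X \<omega> = \<infinity>"
proof -
  note [measurable_cong] = sets_Q
  have "emeasure (Q x) {\<omega>\<in>space M. clock_total X \<omega> \<in> {..<\<infinity>}} =
      emeasure (Q 1) {\<omega>\<in>space M. ennreal (x powr (\<alpha> - 1)) * clock_total X \<omega> \<in> {..<\<infinity>}}"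
    by (rule clock_total_self_similar) (use assms in auto)
  also have "\<dots> = emeasure (Q 1) {\<omega>\<in>space M. clock_total X \<omega> < \<infinity>}"
    using assms by (intro arg_cong2[where f=emeasure] refl Collect_cong) (auto simp: ennreal_mult_less_top)
  also have "\<dots> = 0"
    using AE_clock_total_infinite_1[OF assms(1)]
    by (subst (asm) AE_iff_measurable[OF _ refl]) (auto simp: space_Q sets_Q less_top)
  finally have "{\<omega>\<in>space M. clock_total X \<omega> < \<infinity>} \<in> null_sets (Q x)"
    using assms by (auto simp: null_sets_def sets_Q)
  then show ?thesis
    by (rule AE_I') (auto simp: space_Q assms less_top)
qed

end

section \<open>The strong Markov property\<close>

lemma right_cont_path_stopped:
  assumes "right_cont_path f"
  shows "right_cont_path (\<lambda>t. f (min t q))"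
  unfolding right_cont_path_def continuous_within
proof (intro allI impI)
  fix t :: real assume t: "0 \<le> t"
  show "((\<lambda>t. f (min t q)) \<longlongrightarrow> f (min t q)) (at_right t)"
  proof (cases "t < q")
    case True
    have "\<forall>\<^sub>F u in at_right t. f u = f (min u q)"
      using True by (intro eventually_at_rightI[of t q]) auto
    with right_cont_path_tendsto[OF assms t] show ?thesis
      using True by (auto elim: tendsto_cong[THEN iffD1, rotated])
  next
    case False
    have "\<forall>\<^sub>F u in at_right t. f (min u q) = f (min t q)"
      using False by (intro eventually_at_rightI[of t "t + 1"]) auto
    then show ?thesis by (rule tendsto_eventually)
  qed
qed

text \<open>If u < A(q), then \<theta>(v) \<le> q for all v \<le> u, so only the path up to
  \<open>q\<close> is consulted, and stopping at \<open>q\<close> does not change it.\<close>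

lemma time_changed_stopped:
  assumes "0 \<le> q" "v \<le> u" "ennreal u < clock X q \<omega>"
  shows "time_changed (\<lambda>t. X (min t q)) v \<omega> = time_changed X v \<omega>"
proof -
  let ?Z = "\<lambda>t. X (min t q)"
  have eq: "clock ?Z s \<omega> = clock X s \<omega>" if "s \<le> q" for s
    using that by (intro clock_cong) auto
  have v: "ennreal v < clock X q \<omega>" using assms ennreal_leI by (meson le_less_trans)
  have "clock_inverse ?Z v \<omega> = clock_inverse X v \<omega>"
  proof (rule clock_inverse_eqI)
    fix s :: real
    show "ennreal v < clock ?Z s \<omega> \<longleftrightarrow> ennreal v < clock X s \<omega>"
    proof (cases "s \<le> q")
      case False
      then show ?thesis
        using v eq[of q] clock_mono[of q s X \<omega>] clock_mono[of q s ?Z \<omega>] by (auto intro: less_le_trans)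
    qed (simp add: eq)
  qed
  moreover have "clock_inverse X v \<omega> \<le> ennreal q" using v assms by (intro clock_inverse_lower)
  then have "enn2real (clock_inverse X v \<omega>) \<le> q" by (rule enn2real_leI[OF assms(1)])
  ultimately show ?thesis by (simp add: time_changed_def min_def)
qed

text \<open>Up to time \<open>A(q)\<close>, the time change of \<open>X\<close> agrees with that of \<open>X\<close> stopped at \<open>q\<close>, which is measurable at time \<open>q\<close>.\<close>

lemma natural_filtration_time_changed:
  assumes meas: "\<And>t. 0 \<le> t \<Longrightarrow> X t \<in> borel_measurable M"
    and rc: "\<And>\<omega>. \<omega> \<in> space M \<Longrightarrow> right_cont_path (\<lambda>t. X t \<omega>)"
    and q: "0 \<le> q" and D: "D \<in> sets (natural_filtration M (time_changed X) (ennreal u))" and u: "0 \<le> u"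
  shows "D \<inter> {\<omega>\<in>space M. ennreal u < clock X q \<omega>} \<in> sets (natural_filtration M X (ennreal q))"
proof -
  let ?I = "{v. 0 \<le> v \<and> ennreal v \<le> ennreal u}" and ?N = "natural_filtration M X (ennreal q)"
  let ?Z = "\<lambda>t. X (min t q)"
  have "(\<lambda>\<omega>. \<lambda>v\<in>?I. time_changed X v \<omega>) \<in> space M \<rightarrow> space (PiM ?I (\<lambda>_. borel))"
    by (auto simp: space_PiM)
  from D[unfolded natural_filtration_def sets_vimage_algebra2[OF this]]
  obtain C where C: "C \<in> sets (PiM ?I (\<lambda>_. borel))"
    "D = (\<lambda>\<omega>. \<lambda>v\<in>?I. time_changed X v \<omega>) -` C \<inter> space M"
    by auto
  have Z: "?Z t \<in> borel_measurable ?N" if "0 \<le> t" for t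
    using that q by (intro measurable_natural_filtration) (auto intro: ennreal_leI)
  have rcZ: "right_cont_path (\<lambda>t. ?Z t \<omega>)" if "\<omega> \<in> space ?N" for \<omega>
    using right_cont_path_stopped[OF rc, of \<omega> q] that by simp
  have [measurable]: "(\<lambda>\<omega>. \<lambda>v\<in>?I. time_changed ?Z v \<omega>) \<in> measurable ?N (PiM ?I (\<lambda>_. borel))"
    by (intro measurable_restrict measurable_time_changed Z rcZ)
  have [measurable]: "clock ?Z q \<in> borel_measurable ?N" by (intro measurable_clock Z rcZ)
  note C(1)[measurable]
  have clock_eq: "clock ?Z q \<omega> = clock X q \<omega>" for \<omega> by (intro clock_cong) auto
  have "(\<lambda>v\<in>?I. time_changed ?Z v \<omega>) = (\<lambda>v\<in>?I. time_changed X v \<omega>)" if "ennreal u < clock X q \<omega>" for \<omega>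
    using that q u by (intro restrict_ext time_changed_stopped) auto
  then have "D \<inter> {\<omega>\<in>space M. ennreal u < clock X q \<omega>} =
      {\<omega>\<in>space ?N. (\<lambda>v\<in>?I. time_changed ?Z v \<omega>) \<in> C \<and> ennreal u < clock ?Z q \<omega>}"
    by (auto simp: C(2) clock_eq)
  also have "\<dots> \<in> sets ?N" by measurable
  finally show ?thesis .
qed

text \<open>The random time \<theta>(T). \<open>clock_inverse\<close> takes real arguments, so T =
  \<infinity> is sent to \<infinity> separately.\<close>

definition clock_inverse_at :: "(real \<Rightarrow> 'w \<Rightarrow> real) \<Rightarrow> ('w \<Rightarrow> ennreal) \<Rightarrow> 'w \<Rightarrow> ennreal" where
  "clock_inverse_at X T \<omega> = (if T \<omega> = \<infinity> then \<infinity> else clock_inverse X (enn2real (T \<omega>)) \<omega>)"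

text \<open>A rational \<open>u\<close> between \<open>T\<close> and A(q) splits the condition into
  T < u, which the time-changed process decides by time \<open>u\<close>, and u < A(q), which
  \<open>X\<close> decides by time \<open>q\<close>.\<close>

lemma clock_inverse_at_less_iff:
  "clock_inverse_at X T \<omega> < r \<longleftrightarrow>
    (\<exists>q\<in>\<rat>. 0 \<le> q \<and> ennreal q < r \<and> (\<exists>u\<in>\<rat>. 0 \<le> u \<and> T \<omega> < ennreal u \<and> ennreal u < clock X q \<omega>))"
proof
  assume less: "clock_inverse_at X T \<omega> < r"
  then have "T \<omega> \<noteq> \<infinity>" by (auto simp: clock_inverse_at_def)
  then obtain \<tau> where \<tau>: "T \<omega> = ennreal \<tau>" "0 \<le> \<tau>" by (cases "T \<omega>") auto
  with less obtain q where q: "q \<in> \<rat>" "0 \<le> q" "ennreal q < r" "ennreal \<tau> < clock X q \<omega>"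
    by (auto simp: clock_inverse_at_def clock_inverse_less_iff)
  obtain u where "u \<in> \<rat>" "\<tau> < u" "ennreal u < clock X q \<omega>"
  proof (cases "clock X q \<omega>")
    case (real c)
    then have "\<tau> < c" using q \<tau> by (simp add: ennreal_less_iff)
    then obtain u where "u \<in> \<rat>" "\<tau> < u" "u < c" using Rats_dense_in_real by blast
    with real \<tau> show ?thesis by (intro that[of u]) (auto simp: ennreal_less_iff)
  next
    case top
    obtain u where "u \<in> \<rat>" "\<tau> < u" using Rats_dense_in_real[of \<tau> "\<tau> + 1"] by auto
    with top show ?thesis by (intro that[of u]) auto
  qed
  then show "\<exists>q\<in>\<rat>. 0 \<le> q \<and> ennreal q < r \<and> (\<exists>u\<in>\<rat>. 0 \<le> u \<and> T \<omega> < ennreal u \<and> ennreal u < clock X q \<omega>)"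
    using q \<tau> by (intro bexI[of _ q] conjI bexI[of _ u]) (auto simp: ennreal_less_iff)
next
  assume "\<exists>q\<in>\<rat>. 0 \<le> q \<and> ennreal q < r \<and> (\<exists>u\<in>\<rat>. 0 \<le> u \<and> T \<omega> < ennreal u \<and> ennreal u < clock X q \<omega>)"
  then obtain q u where q: "q \<in> \<rat>" "0 \<le> q" "ennreal q < r" and u: "T \<omega> < ennreal u" "ennreal u < clock X q \<omega>"
    by auto
  then have "T \<omega> < clock X q \<omega>" "T \<omega> \<noteq> \<infinity>" by auto
  with q show "clock_inverse_at X T \<omega> < r"
    by (auto simp: clock_inverse_at_def clock_inverse_less_iff less_top)
qed

text \<open>Stopping times provide events with a weak inequality; this recovers the strict one by a
  countable union.\<close>

lemma less_ennreal_rat_iff: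
  "y < ennreal u \<longleftrightarrow> (\<exists>w\<in>\<rat>. 0 \<le> w \<and> w < u \<and> y \<le> ennreal w)"
proof
  assume y: "y < ennreal u"
  then obtain \<tau> where \<tau>: "y = ennreal \<tau>" "0 \<le> \<tau>" by (cases y) auto
  with y have "\<tau> < u" by (simp add: ennreal_less_iff)
  then obtain w where "w \<in> \<rat>" "\<tau> < w" "w < u" using Rats_dense_in_real by blast
  with \<tau> show "\<exists>w\<in>\<rat>. 0 \<le> w \<and> w < u \<and> y \<le> ennreal w" by (auto intro!: bexI[of _ w] ennreal_leI)
next
  assume "\<exists>w\<in>\<rat>. 0 \<le> w \<and> w < u \<and> y \<le> ennreal w"
  then show "y < ennreal u" by (auto intro: le_less_trans simp: ennreal_less_iff)
qed

context
  fixes X :: "real \<Rightarrow> 'w \<Rightarrow> real" and M :: "'w measure" and T :: "'w \<Rightarrow> ennreal" and B :: "'w set"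
  assumes meas: "\<And>t. 0 \<le> t \<Longrightarrow> X t \<in> borel_measurable M"
    and rc: "\<And>\<omega>. \<omega> \<in> space M \<Longrightarrow> right_cont_path (\<lambda>t. X t \<omega>)"
    and T: "stopping_time (natural_filtration_right M (time_changed X)) T"
    and B: "B \<in> sets (filtration.pre_sigma (space M) (natural_filtration_right M (time_changed X)) T)"
begin

lemma pre_sigma_le_sets: "{\<omega>\<in>B. T \<omega> \<le> t} \<in> sets (natural_filtration_right M (time_changed X) t)"
  using filtration.sets_pre_sigmaD[OF filtration_natural_filtration_right T B] .

text \<open>A countable union over the rationals \<open>q\<close>, \<open>u\<close> of events known
  at time \<open>q\<close>. The set \<open>B\<close> is carried along so that stopping times and
  their pasts are treated together.\<close>

lemma clock_inverse_at_less_sets: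
  "{\<omega>\<in>B. clock_inverse_at X T \<omega> < r} \<in> sets (natural_filtration M X r)"
proof -
  let ?Q = "\<lambda>r. {q\<in>\<rat>. 0 \<le> q \<and> ennreal q < r}"
  have cnt: "countable (?Q r)" for r by (rule countable_subset[OF _ countable_rat]) auto
  \<comment> \<open>For w < u the right limit at \<open>w\<close> is contained in the plain
    filtration at \<open>u\<close>, so the strict inequality removes the right limit.\<close>
  have pre_sigma_le_setsss: "{\<omega>\<in>B. T \<omega> < ennreal u} \<in> sets (natural_filtration M (time_changed X) (ennreal u))" for u
  proof -
    have "{\<omega>\<in>B. T \<omega> < ennreal u} = (\<Union>w\<in>{w\<in>\<rat>. 0 \<le> w \<and> w < u}. {\<omega>\<in>B. T \<omega> \<le> ennreal w})"
      unfolding less_ennreal_rat_iff by auto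
    also have "\<dots> \<in> sets (natural_filtration M (time_changed X) (ennreal u))"
    proof (rule sets.countable_UN'[OF _ image_subsetI])
      show "countable {w\<in>\<rat>. 0 \<le> w \<and> w < u}" by (rule countable_subset[OF _ countable_rat]) auto
      fix w assume "w \<in> {w\<in>\<rat>. 0 \<le> w \<and> w < u}"
      then show "{\<omega>\<in>B. T \<omega> \<le> ennreal w} \<in> sets (natural_filtration M (time_changed X) (ennreal u))"
        using pre_sigma_le_sets[of "ennreal w"]
          natural_filtration_right_subset[of "ennreal w" "ennreal u" M "time_changed X"]
        by (auto simp: ennreal_less_iff)
    qed
    finally show ?thesis .
  qed
  have "B \<subseteq> space M" using pre_sigma_le_sets[of \<infinity>] sets.sets_into_space by (force simp: space_natural_filtration_right)
  then have "{\<omega>\<in>B. clock_inverse_at X T \<omega> < r} = (\<Union>q\<in>?Q r. \<Union>u\<in>?Q \<infinity>.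
      {\<omega>\<in>B. T \<omega> < ennreal u} \<inter> {\<omega>\<in>space M. ennreal u < clock X q \<omega>})"
    unfolding clock_inverse_at_less_iff by auto
  also have "\<dots> \<in> sets (natural_filtration M X r)"
  proof (rule sets.countable_UN'[OF cnt], rule image_subsetI, rule sets.countable_UN'[OF cnt], rule image_subsetI)
    fix q u assume q: "q \<in> ?Q r" and u: "u \<in> ?Q \<infinity>"
    have "{\<omega>\<in>B. T \<omega> < ennreal u} \<inter> {\<omega>\<in>space M. ennreal u < clock X q \<omega>} \<in> sets (natural_filtration M X (ennreal q))"
      using q u by (intro natural_filtration_time_changed meas rc pre_sigma_le_setsss) auto
    then show "{\<omega>\<in>B. T \<omega> < ennreal u} \<inter> {\<omega>\<in>space M. ennreal u < clock X q \<omega>} \<in> sets (natural_filtration M X r)"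
      using natural_filtration_mono[of "ennreal q" r M X] q less_imp_le by blast
  qed
  finally show ?thesis .
qed

text \<open>The weak inequality is an intersection of strict ones at times decreasing to
  \<open>t\<close>; this is where right limits of the filtration are needed.\<close>

lemma clock_inverse_at_le_sets:
  "{\<omega>\<in>B. clock_inverse_at X T \<omega> \<le> t} \<in> sets (natural_filtration_right M X t)"
proof (cases "t = \<infinity>")
  \<comment> \<open>At t = \<infinity> the set is \<open>B\<close> itself, which is known to the
    whole time-changed process and hence to the whole of \<open>X\<close>.\<close>
  case True
  have "sets (natural_filtration M (time_changed X) \<infinity>) \<subseteq> sets (natural_filtration M X \<infinity>)"
    by (intro sets_natural_filtration_subset measurable_time_changed measurable_natural_filtration rc) auto
  moreover have "{\<omega>\<in>B. T \<omega> \<le> \<infinity>} \<in> sets (natural_filtration M (time_changed X) (\<infinity> + 1))"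
    using pre_sigma_le_sets[of \<infinity>] unfolding sets_natural_filtration_right by (rule INT_D) simp
  ultimately have "B \<in> sets (natural_filtration M X \<infinity>)" by auto
  then show ?thesis
    unfolding sets_natural_filtration_right True by (intro INT_I) simp
next
  case False
  show ?thesis unfolding sets_natural_filtration_right
  proof safe
    fix \<epsilon> :: ennreal assume \<epsilon>: "0 < \<epsilon>"
    \<comment> \<open>The cap \<epsilon> keeps every event of the intersection within the filtration
      at t + \<epsilon>.\<close>
    let ?e = "\<lambda>n. min \<epsilon> (ennreal (inverse (real (Suc n))))"
    have "clock_inverse_at X T \<omega> \<le> t \<longleftrightarrow> (\<forall>n. clock_inverse_at X T \<omega> < t + ?e n)" for \<omega>
    proof safe
      fix n assume "clock_inverse_at X T \<omega> \<le> t"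
      moreover have "t < t + ?e n"
        using False \<epsilon> ennreal_add_left_cancel_less[of t 0 "?e n"] by (auto simp: min_def)
      ultimately show "clock_inverse_at X T \<omega> < t + ?e n" by (rule le_less_trans)
    next
      assume less: "\<forall>n. clock_inverse_at X T \<omega> < t + ?e n"
      show "clock_inverse_at X T \<omega> \<le> t"
      proof (rule ennreal_le_epsilon)
        fix e :: real assume "0 < e"
        then obtain n where "inverse (real (Suc n)) < e" using reals_Archimedean by auto
        then have "t + ?e n \<le> t + ennreal e" by (intro add_left_mono min.coboundedI2 ennreal_leI) simp
        then show "clock_inverse_at X T \<omega> \<le> t + ennreal e" using less by (meson less_imp_le order_trans)
      qed
    qed
    then have "{\<omega>\<in>B. clock_inverse_at X T \<omega> \<le> t} = (\<Inter>n. {\<omega>\<in>B. clock_inverse_at X T \<omega> < t + ?e n})"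
      by auto
    also have "\<dots> \<in> sets (natural_filtration M X (t + \<epsilon>))"
    proof (rule sets.countable_INT[OF image_subsetI])
      fix n :: nat
      show "{\<omega>\<in>B. clock_inverse_at X T \<omega> < t + ?e n} \<in> sets (natural_filtration M X (t + \<epsilon>))"
        using clock_inverse_at_less_sets[of "t + ?e n"]
          natural_filtration_mono[of "t + ?e n" "t + \<epsilon>" M X] by (auto intro: add_left_mono)
    qed simp
    finally show "{\<omega>\<in>B. clock_inverse_at X T \<omega> \<le> t} \<in> sets (natural_filtration M X (t + \<epsilon>))" .
  qed
qed

end

text \<open>The full space, as event \<open>B\<close>, gives the stopping time property; a general
  \<open>B\<close> gives the comparison of pasts.\<close>

lemma
  assumes meas: "\<And>t. 0 \<le> t \<Longrightarrow> X t \<in> borel_measurable M"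
    and rc: "\<And>\<omega>. \<omega> \<in> space M \<Longrightarrow> right_cont_path (\<lambda>t. X t \<omega>)"
    and T: "stopping_time (natural_filtration_right M (time_changed X)) T"
  shows stopping_time_clock_inverse_at:
      "stopping_time (natural_filtration_right M X) (clock_inverse_at X T)"
    and pre_sigma_clock_inverse_at:
      "B \<in> sets (filtration.pre_sigma (space M) (natural_filtration_right M (time_changed X)) T) \<Longrightarrow>
       B \<in> sets (filtration.pre_sigma (space M) (natural_filtration_right M X) (clock_inverse_at X T))"
proof -
  interpret Y: filtration "space M" "natural_filtration_right M (time_changed X)"
    by (rule filtration_natural_filtration_right)
  have space: "space M \<in> sets (Y.pre_sigma T)"
    using sets.top[of "Y.pre_sigma T"] by (simp add: Y.space_pre_sigma)
  show st: "stopping_time (natural_filtration_right M X) (clock_inverse_at X T)"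
    using clock_inverse_at_le_sets[OF meas rc T space]
    by (auto simp: stopping_time_def pred_def space_natural_filtration_right)
  show "B \<in> sets (filtration.pre_sigma (space M) (natural_filtration_right M X) (clock_inverse_at X T))"
    if "B \<in> sets (Y.pre_sigma T)"
    using clock_inverse_at_le_sets[OF meas rc T that]
    by (intro filtration.sets_pre_sigmaI[OF filtration_natural_filtration_right st])
qed

context pssMp
begin

text \<open>The strong Markov property of \<open>X\<close> at S = \<theta>(T), applied to the event
  \<open>C'\<close> of paths whose time change lies in \<open>C\<close>. The future of the
  time-changed process after \<open>T\<close> is the time change of the future of \<open>X\<close>
  after \<open>S\<close>.\<close>

lemma strong_markov_time_changed:
  assumes x: "0 < x"
    and T: "stopping_time (natural_filtration_right M (time_changed X)) T"
    and B: "B \<in> sets (filtration.pre_sigma (space M) (natural_filtration_right M (time_changed X)) T)"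
    and C: "C \<in> sets path_space"
  shows "emeasure (Q x) {\<omega>\<in>B. T \<omega> < \<infinity> \<and> time_changed X (enn2real (T \<omega>)) \<omega> > 0 \<and>
        sample_path (\<lambda>u. time_changed X (enn2real (T \<omega>) + u)) \<omega> \<in> C} =
      (\<integral>\<^sup>+\<omega>\<in>{\<omega>\<in>B. T \<omega> < \<infinity> \<and> time_changed X (enn2real (T \<omega>)) \<omega> > 0}.
        emeasure (Q (time_changed X (enn2real (T \<omega>)) \<omega>)) {\<omega>'\<in>space M. sample_path (time_changed X) \<omega>' \<in> C} \<partial>Q x)"
proof -
  let ?Y = "time_changed X" and ?S = "clock_inverse_at X T"
  obtain C' where C': "C' \<in> sets path_space"
    "\<And>X (\<omega>::'w). right_cont_path (\<lambda>t. X t \<omega>) \<Longrightarrow> sample_path (time_changed X) \<omega> \<in> C \<longleftrightarrow> sample_path X \<omega> \<in> C'"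
    using time_changed_set_lift[OF C] by blast
  note S = stopping_time_clock_inverse_at[OF measurable_X right_cont T]
  note BS = pre_sigma_clock_inverse_at[OF measurable_X right_cont T B]
  have "B \<subseteq> space M"
    using sets.sets_into_space[OF BS] filtration.space_pre_sigma[OF filtration_natural_filtration_right, of M X] by simp
  \<comment> \<open>Where \<theta>(T) is infinite with T finite, the time-changed process is 0, so
    both conditions fail together.\<close>
  have iff: "T \<omega> < \<infinity> \<and> 0 < ?Y (enn2real (T \<omega>)) \<omega> \<longleftrightarrow> ?S \<omega> < \<infinity> \<and> 0 < X (enn2real (?S \<omega>)) \<omega>"
    and eq: "?S \<omega> < \<infinity> \<Longrightarrow> ?Y (enn2real (T \<omega>)) \<omega> = X (enn2real (?S \<omega>)) \<omega>" for \<omega>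
    by (cases "T \<omega> = \<infinity>"; cases "clock_inverse X (enn2real (T \<omega>)) \<omega> = \<infinity>";
        simp add: clock_inverse_at_def time_changed_def less_top[symmetric])+
  have path: "sample_path (\<lambda>u. ?Y (enn2real (T \<omega>) + u)) \<omega> \<in> C \<longleftrightarrow>
      sample_path (\<lambda>u. X (enn2real (?S \<omega>) + u)) \<omega> \<in> C'"
    if \<omega>: "\<omega> \<in> space M" "?S \<omega> < \<infinity>" "0 < X (enn2real (?S \<omega>)) \<omega>" for \<omega>
  proof -
    have "clock_inverse X (enn2real (T \<omega>)) \<omega> = ennreal (enn2real (?S \<omega>))"
      using \<omega>(2) by (cases "T \<omega> = \<infinity>") (simp_all add: clock_inverse_at_def)
    then have "sample_path (\<lambda>u. ?Y (enn2real (T \<omega>) + u)) \<omega> =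
        sample_path (time_changed (\<lambda>u. X (enn2real (?S \<omega>) + u))) \<omega>"
      unfolding sample_path_def using \<omega>
      by (intro restrict_ext time_changed_shift right_cont) auto
    moreover have "right_cont_path (\<lambda>u. X (enn2real (?S \<omega>) + u) \<omega>)"
      using \<omega> by (intro right_cont_shifted) auto
    ultimately show ?thesis by (simp add: C'(2))
  qed
  have event: "T \<omega> < \<infinity> \<and> ?Y (enn2real (T \<omega>)) \<omega> > 0 \<and> sample_path (\<lambda>u. ?Y (enn2real (T \<omega>) + u)) \<omega> \<in> C \<longleftrightarrow>
      ?S \<omega> < \<infinity> \<and> X (enn2real (?S \<omega>)) \<omega> > 0 \<and> sample_path (\<lambda>u. X (enn2real (?S \<omega>) + u)) \<omega> \<in> C'"
    if "\<omega> \<in> B" for \<omega>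
    using iff[of \<omega>] path[of \<omega>] that \<open>B \<subseteq> space M\<close> by blast
  then have "{\<omega>\<in>B. T \<omega> < \<infinity> \<and> ?Y (enn2real (T \<omega>)) \<omega> > 0 \<and> sample_path (\<lambda>u. ?Y (enn2real (T \<omega>) + u)) \<omega> \<in> C} =
    {\<omega>\<in>B. ?S \<omega> < \<infinity> \<and> X (enn2real (?S \<omega>)) \<omega> > 0 \<and> sample_path (\<lambda>u. X (enn2real (?S \<omega>) + u)) \<omega> \<in> C'}"
    by (intro Collect_cong) (rule conj_cong[OF refl event])
  then have "emeasure (Q x) {\<omega>\<in>B. T \<omega> < \<infinity> \<and> ?Y (enn2real (T \<omega>)) \<omega> > 0 \<and>
        sample_path (\<lambda>u. ?Y (enn2real (T \<omega>) + u)) \<omega> \<in> C} =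
      (\<integral>\<^sup>+\<omega>\<in>{\<omega>\<in>B. ?S \<omega> < \<infinity> \<and> X (enn2real (?S \<omega>)) \<omega> > 0}.
        emeasure (Q (X (enn2real (?S \<omega>)) \<omega>)) {\<omega>'\<in>space M. sample_path X \<omega>' \<in> C'} \<partial>Q x)"
    using strong_markov[OF x S BS C'(1)] by (rule ssubst)
  also have "{\<omega>'\<in>space M. sample_path X \<omega>' \<in> C'} = {\<omega>'\<in>space M. sample_path ?Y \<omega>' \<in> C}"
    using C'(2)[of X, OF right_cont] by auto
  also have "(\<integral>\<^sup>+\<omega>\<in>{\<omega>\<in>B. ?S \<omega> < \<infinity> \<and> X (enn2real (?S \<omega>)) \<omega> > 0}.
        emeasure (Q (X (enn2real (?S \<omega>)) \<omega>)) {\<omega>'\<in>space M. sample_path ?Y \<omega>' \<in> C} \<partial>Q x) =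
      (\<integral>\<^sup>+\<omega>\<in>{\<omega>\<in>B. T \<omega> < \<infinity> \<and> ?Y (enn2real (T \<omega>)) \<omega> > 0}.
        emeasure (Q (?Y (enn2real (T \<omega>)) \<omega>)) {\<omega>'\<in>space M. sample_path ?Y \<omega>' \<in> C} \<partial>Q x)"
  proof (rule nn_integral_cong)
    fix \<omega>
    let ?I = "{\<omega>\<in>B. ?S \<omega> < \<infinity> \<and> X (enn2real (?S \<omega>)) \<omega> > 0}"
    let ?J = "{\<omega>\<in>B. T \<omega> < \<infinity> \<and> ?Y (enn2real (T \<omega>)) \<omega> > 0}"
    have mem: "\<omega> \<in> ?I \<longleftrightarrow> \<omega> \<in> ?J" using iff[of \<omega>] by blast
    show "emeasure (Q (X (enn2real (?S \<omega>)) \<omega>)) {\<omega>'\<in>space M. sample_path ?Y \<omega>' \<in> C} * indicator ?I \<omega> =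
        emeasure (Q (?Y (enn2real (T \<omega>)) \<omega>)) {\<omega>'\<in>space M. sample_path ?Y \<omega>' \<in> C} * indicator ?J \<omega>"
    proof (cases "\<omega> \<in> ?I")
      case True
      then have "?Y (enn2real (T \<omega>)) \<omega> = X (enn2real (?S \<omega>)) \<omega>" by (intro eq) blast
      then show ?thesis using True mem by (simp only: indicator_simps)
    next
      case False
      then have "\<omega> \<notin> ?J" using mem by blast
      with False show ?thesis by (simp only: indicator_simps mult_zero_right not_False_eq_True)
    qed
  qed
  finally show ?thesis .
qed

section \<open>The time-changed process is a pssMp of index \<alpha> - 1\<close>

lemma measurable_time_changed_X: "time_changed X t \<in> borel_measurable M"
  by (intro measurable_time_changed measurable_X right_cont)

text \<open>The rescaled time change is the time change of
  \<open>k * X (k powr (-\<alpha>) * t)\<close>, and the latter process has the law of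
  \<open>X\<close> under \<open>Q (k * x)\<close>.\<close>

lemma self_similar_time_changed:
  assumes "0 < x" "0 < k"
  shows "process_law (Q x) (\<lambda>t \<omega>. k * time_changed X (k powr (-(\<alpha> - 1)) * t) \<omega>) = process_law (Q (k * x)) (time_changed X)"
proof (rule measure_eqI)
  fix C assume "C \<in> sets (process_law (Q x) (\<lambda>t \<omega>. k * time_changed X (k powr (-(\<alpha> - 1)) * t) \<omega>))"
  then have C: "C \<in> sets path_space" by (simp add: process_law_def)
  obtain C' where C': "C' \<in> sets path_space"
    "\<And>X (\<omega>::'w). right_cont_path (\<lambda>t. X t \<omega>) \<Longrightarrow> sample_path (time_changed X) \<omega> \<in> C \<longleftrightarrow> sample_path X \<omega> \<in> C'"
    using time_changed_set_lift[OF C] by blast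
  let ?Z = "\<lambda>t \<omega>. k * X (k powr (-\<alpha>) * t) \<omega>"
  have exponent: "k * k powr (-\<alpha>) = k powr (-(\<alpha> - 1))"
    using assms by (simp add: powr_diff powr_minus field_simps)
  have path: "sample_path (\<lambda>t \<omega>. k * time_changed X (k powr (-(\<alpha> - 1)) * t) \<omega>) \<omega> \<in> C \<longleftrightarrow> sample_path ?Z \<omega> \<in> C'"
    if \<omega>: "\<omega> \<in> space M" for \<omega>
  proof -
    have "k * time_changed X (k powr (-(\<alpha> - 1)) * t) \<omega> = time_changed ?Z t \<omega>" if "0 \<le> t" for t
      using time_changed_scale[of X \<omega> k "k powr (-\<alpha>)" t, OF right_cont[OF \<omega>]] assms that
      unfolding exponent by simp
    then have "sample_path (\<lambda>t \<omega>. k * time_changed X (k powr (-(\<alpha> - 1)) * t) \<omega>) \<omega> = sample_path (time_changed ?Z) \<omega>"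
      unfolding sample_path_def by (intro restrict_ext) auto
    moreover have "right_cont_path (\<lambda>t. ?Z t \<omega>)" using assms \<omega> by (intro right_cont_scaled) auto
    ultimately show ?thesis by (simp add: C'(2))
  qed
  have "emeasure (process_law (Q x) (\<lambda>t \<omega>. k * time_changed X (k powr (-(\<alpha> - 1)) * t) \<omega>)) C =
      emeasure (Q x) {\<omega>\<in>space M. sample_path ?Z \<omega> \<in> C'}"
    using assms C path measurable_time_changed_X
    by (subst emeasure_process_law) (auto cong: conj_cong)
  also have "\<dots> = emeasure (Q (k * x)) {\<omega>\<in>space M. sample_path X \<omega> \<in> C'}"
    by (rule self_similar_event[symmetric]) (use assms C' in auto)
  also have "\<dots> = emeasure (process_law (Q (k * x)) (time_changed X)) C"
    using assms C C'(2)[of X, OF right_cont] measurable_time_changed_X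
    by (subst emeasure_process_law) (auto cong: conj_cong)
  finally show "emeasure (process_law (Q x) (\<lambda>t \<omega>. k * time_changed X (k powr (-(\<alpha> - 1)) * t) \<omega>)) C =
      emeasure (process_law (Q (k * x)) (time_changed X)) C" .
qed (simp add: process_law_def)

lemma law_measurable_time_changed:
  assumes "C \<in> sets path_space"
  shows "(\<lambda>x. emeasure (Q x) {\<omega>\<in>space M. sample_path (time_changed X) \<omega> \<in> C}) \<in>
    borel_measurable (restrict_space borel {0<..})"
proof -
  obtain C' where C': "C' \<in> sets path_space"
    "\<And>X (\<omega>::'w). right_cont_path (\<lambda>t. X t \<omega>) \<Longrightarrow> sample_path (time_changed X) \<omega> \<in> C \<longleftrightarrow> sample_path X \<omega> \<in> C'"
    using time_changed_set_lift[OF assms] by blast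
  then show ?thesis
    using law_measurable[OF C'(1)] C'(2)[of X, OF right_cont] by (simp cong: conj_cong)
qed

text \<open>\<alpha> > 1 enters through the positivity of the new index and through the infinite
  total clock on which the almost sure left limits rest.\<close>

theorem pssMp_time_changed:
  assumes "1 < \<alpha>"
  shows "pssMp (\<alpha> - 1) M Q (time_changed X)"
proof (rule pssMp.intro)
  show "AE \<omega> in Q x. left_limits_path (\<lambda>t. time_changed X t \<omega>)" if "0 < x" for x
    using AE_clock_total_infinite[OF assms that] left_limits[OF that] AE_space
  proof eventually_elim
    case (elim \<omega>)
    then show ?case
      using time_changed_left_limits[of X \<omega>, OF right_cont] that by (simp add: space_Q)
  qed
  show "AE \<omega> in Q x. time_changed X 0 \<omega> = x" if "0 < x" for x
    using initial[OF that] AE_space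
  proof eventually_elim
    case (elim \<omega>)
    then show ?case using time_changed_0[of X \<omega>, OF right_cont] that by (simp add: space_Q)
  qed
  show "time_changed X t \<omega> = 0"
    if "0 \<le> s" "s \<le> t" "\<omega> \<in> space M" "time_changed X s \<omega> = 0" for s t \<omega>
    using absorbed that by (intro time_changed_absorbed[of X \<omega> s t]) auto
  show "right_cont_path (\<lambda>t. time_changed X t \<omega>)" if "\<omega> \<in> space M" for \<omega>
    by (rule time_changed_right_cont[of X \<omega>, OF right_cont[OF that]])
  show "0 \<le> time_changed X t \<omega>" if "0 \<le> t" "\<omega> \<in> space M" for t \<omega>
    using nonneg that by (intro time_changed_nonneg) auto
  show "C \<in> sets path_space \<Longrightarrow>
      (\<lambda>x. emeasure (Q x) {\<omega>\<in>space M. sample_path (time_changed X) \<omega> \<in> C}) \<in>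
        borel_measurable (restrict_space borel {0<..})" for C
    by (rule law_measurable_time_changed)
  show "time_changed X t \<in> borel_measurable M" for t by (rule measurable_time_changed_X)
  show "0 < x \<Longrightarrow> 0 < k \<Longrightarrow>
      process_law (Q x) (\<lambda>t \<omega>. k * time_changed X (k powr (-(\<alpha> - 1)) * t) \<omega>) =
      process_law (Q (k * x)) (time_changed X)" for x k
    by (rule self_similar_time_changed)
  show "emeasure (Q x) {\<omega>\<in>B. T \<omega> < \<infinity> \<and> time_changed X (enn2real (T \<omega>)) \<omega> > 0 \<and>
        sample_path (\<lambda>u. time_changed X (enn2real (T \<omega>) + u)) \<omega> \<in> C} =
      (\<integral>\<^sup>+\<omega>\<in>{\<omega>\<in>B. T \<omega> < \<infinity> \<and> time_changed X (enn2real (T \<omega>)) \<omega> > 0}.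
        emeasure (Q (time_changed X (enn2real (T \<omega>)) \<omega>)) {\<omega>'\<in>space M. sample_path (time_changed X) \<omega>' \<in> C} \<partial>Q x)"
    if "0 < x" "stopping_time (natural_filtration_right M (time_changed X)) T"
      "B \<in> sets (filtration.pre_sigma (space M) (natural_filtration_right M (time_changed X)) T)"
      "C \<in> sets path_space" for x T B C
    by (rule strong_markov_time_changed[OF that])
  show "0 < x \<Longrightarrow> prob_space (Q x)" "0 < x \<Longrightarrow> sets (Q x) = sets M" for x
    by (fact prob_space_Q sets_Q)+
qed (use assms in simp)

end

section \<open>The Lamperti representation\<close>

text \<open>One-sided limits bound the path near each point, and bisection joins local bounds to one
  on the compact interval.\<close>

lemma cadlag_path_bounded:
  assumes "cadlag_path f" "0 \<le> s"
  obtains K where "\<And>u. 0 \<le> u \<Longrightarrow> u \<le> s \<Longrightarrow> \<bar>f u\<bar> \<le> K"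
proof -
  \<comment> \<open>Bisection also asks about intervals that extend below 0; the condition
    \<open>0 \<le> u\<close> keeps negative times out.\<close>
  let ?P = "\<lambda>a b. \<exists>K. \<forall>u. 0 \<le> u \<and> a \<le> u \<and> u \<le> b \<longrightarrow> \<bar>f u\<bar> \<le> K"
  have "?P 0 s"
  proof (rule Bolzano[where P="?P", OF assms(2)])
    fix a b c assume "?P a b" "?P b c"
    then obtain K1 K2 where K: "\<forall>u. 0 \<le> u \<and> a \<le> u \<and> u \<le> b \<longrightarrow> \<bar>f u\<bar> \<le> K1"
      "\<forall>u. 0 \<le> u \<and> b \<le> u \<and> u \<le> c \<longrightarrow> \<bar>f u\<bar> \<le> K2" by blast
    have "\<bar>f u\<bar> \<le> max K1 K2" if "0 \<le> u \<and> a \<le> u \<and> u \<le> c" for u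
      using K that by (cases "u \<le> b") (simp_all add: le_max_iff_disj)
    then show "?P a c" by blast
  next
    fix x assume local: "0 \<le> x" "x \<le> s"
    have "(f \<longlongrightarrow> f x) (at_right x)"
      using assms local by (intro right_cont_path_tendsto) (auto simp: cadlag_path_def)
    then have "\<forall>\<^sub>F u in at_right x. \<bar>f u\<bar> < \<bar>f x\<bar> + 1"
      by (intro order_tendstoD(2)[OF tendsto_rabs]) auto
    then obtain b where b: "x < b" "\<And>u. x < u \<Longrightarrow> u < b \<Longrightarrow> \<bar>f u\<bar> < \<bar>f x\<bar> + 1"
      by (auto simp: eventually_at_right_field)
    obtain a l where a: "a < x" "\<And>u. 0 \<le> u \<Longrightarrow> a < u \<Longrightarrow> u < x \<Longrightarrow> \<bar>f u\<bar> < l"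
    proof (cases "x = 0")
      case True
      \<comment> \<open>There is no time in [0,0), so any left bound serves.\<close>
      show ?thesis by (rule that[of "-1" 0]) (use True in auto)
    next
      case False
      then have "0 < x" using local by simp
      with assms(1) obtain l where "(f \<longlongrightarrow> l) (at_left x)"
        unfolding cadlag_path_def left_limits_path_def by blast
      then have "\<forall>\<^sub>F u in at_left x. \<bar>f u\<bar> < \<bar>l\<bar> + 1"
        by (intro order_tendstoD(2)[OF tendsto_rabs]) auto
      then show ?thesis using that by (auto simp: eventually_at_left_field)
    qed
    have bound: "\<bar>f u\<bar> \<le> max l (\<bar>f x\<bar> + 1)" if "0 \<le> u" "a < u" "u < b" for u
      using a(2)[of u] b(2)[of u] that by (cases u x rule: linorder_cases) auto
    have "?P a' b'" if "a' \<le> x \<and> x \<le> b' \<and> b' - a' < min (b - x) (x - a)" for a' b'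
      using that by (intro exI[of _ "max l (\<bar>f x\<bar> + 1)"] allI impI bound) auto
    moreover have "0 < min (b - x) (x - a)" using a b by simp
    ultimately show "\<exists>d>0. \<forall>a b. a \<le> x \<and> x \<le> b \<and> b - a < d \<longrightarrow> ?P a b" by blast
  qed
  then show ?thesis using that by blast
qed

section \<open>Exponential clocks of a fixed killed path\<close>

lemma exp_killed_kill_at:
  "0 < \<beta> \<Longrightarrow> exp_killed (ereal \<beta> * kill_at f e u) = (if ereal u < e then exp (\<beta> * f u) else 0)"
  by (simp add: exp_killed_def kill_at_def)

text \<open>The integrand exp(\<beta> h) of the exponential clock as a real function on the whole
  line, constant on negative times so that it is Borel.\<close>

definition killed_exp :: "(real \<Rightarrow> real) \<Rightarrow> ereal \<Rightarrow> real \<Rightarrow> real \<Rightarrow> real" where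
  "killed_exp f e \<beta> u = (if ereal (max 0 u) < e then exp (\<beta> * f (max 0 u)) else 0)"

context
  fixes f :: "real \<Rightarrow> real" and e :: ereal and h :: "real \<Rightarrow> ereal"
  assumes cadlag: "cadlag_path f" and e_pos: "0 < e" and h: "\<And>u. 0 \<le> u \<Longrightarrow> h u = kill_at f e u"
begin

lemma measurable_killed_exp [measurable]: "killed_exp f e \<beta> \<in> borel_measurable borel"
proof -
  have [measurable]: "(\<lambda>t. f (max 0 t)) \<in> borel_measurable borel"
    using cadlag by (intro measurable_right_cont_path) (simp add: cadlag_path_def)
  show ?thesis unfolding killed_exp_def[abs_def] by measurable
qed

lemma killed_exp_nonneg: "0 \<le> killed_exp f e \<beta> u"
  by (simp add: killed_exp_def)

lemma exp_clock_killed_exp: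
  assumes "0 < \<beta>"
  shows "exp_clock \<beta> h s = (\<integral>\<^sup>+u. ennreal (killed_exp f e \<beta> u) * indicator {0..s} u \<partial>lborel)"
    "exp_clock_total \<beta> h = (\<integral>\<^sup>+u. ennreal (killed_exp f e \<beta> u) * indicator {0..} u \<partial>lborel)"
  unfolding exp_clock_def exp_clock_total_def using assms
  by (auto intro!: nn_integral_cong simp: indicator_def h exp_killed_kill_at killed_exp_def max_absorb2
      e_pos[unfolded zero_ereal_def])

lemma killed_exp_bounded:
  assumes "0 < \<beta>"
  obtains K where "0 < K" "\<And>u. u \<le> s \<Longrightarrow> killed_exp f e \<beta> u \<le> K"
proof -
  obtain K where K: "\<And>u. 0 \<le> u \<Longrightarrow> u \<le> max 0 s \<Longrightarrow> \<bar>f u\<bar> \<le> K"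
    using cadlag_path_bounded[OF cadlag, of "max 0 s"] by auto
  show ?thesis
  proof (rule that[of "exp (\<beta> * K)"])
    fix u assume "u \<le> s"
    then have "\<bar>f (max 0 u)\<bar> \<le> K" by (intro K) auto
    then have "\<beta> * f (max 0 u) \<le> \<beta> * K" using assms by (intro mult_left_mono) auto
    then show "killed_exp f e \<beta> u \<le> exp (\<beta> * K)" by (simp add: killed_exp_def)
  qed simp
qed

text \<open>The clock is finite at real times, so nothing is lost, and continuity and the
  intermediate value theorem become available.\<close>

definition real_exp_clock :: "real \<Rightarrow> real \<Rightarrow> real" where "real_exp_clock \<beta> s = enn2real (exp_clock \<beta> h s)"

text \<open>The integrand is bounded up to \<open>r\<close>; the estimate yields both finiteness and
  Lipschitz continuity of the clock.\<close>

lemma exp_clock_increment_le: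
  assumes "0 < \<beta>"
  obtains K where "0 < K"
    "\<And>s t. 0 \<le> s \<Longrightarrow> s \<le> t \<Longrightarrow> t \<le> r \<Longrightarrow>
      (\<integral>\<^sup>+u. ennreal (killed_exp f e \<beta> u) * indicator {s..t} u \<partial>lborel) \<le> ennreal (K * (t - s))"
proof -
  obtain K where K: "0 < K" "\<And>u. u \<le> r \<Longrightarrow> killed_exp f e \<beta> u \<le> K"
    using killed_exp_bounded[OF assms] by blast
  show ?thesis
  proof (rule that[OF K(1)])
    fix s t assume st: "0 \<le> s" "s \<le> t" "t \<le> r"
    have "(\<integral>\<^sup>+u. ennreal (killed_exp f e \<beta> u) * indicator {s..t} u \<partial>lborel) \<le> (\<integral>\<^sup>+u. ennreal K * indicator {s..t} u \<partial>lborel)"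
      using K st by (intro nn_integral_mono) (auto simp: indicator_def intro!: ennreal_leI)
    also have "\<dots> = ennreal (K * (t - s))"
      using K st by (simp add: nn_integral_cmult_indicator ennreal_mult'')
    finally show "(\<integral>\<^sup>+u. ennreal (killed_exp f e \<beta> u) * indicator {s..t} u \<partial>lborel) \<le> ennreal (K * (t - s))" .
  qed
qed

lemma exp_clock_eq_real:
  assumes "0 < \<beta>"
  shows "exp_clock \<beta> h s = ennreal (real_exp_clock \<beta> s)"
proof -
  obtain K where K: "0 < K"
    "\<And>t. 0 \<le> t \<Longrightarrow> t \<le> max 0 s \<Longrightarrow>
      (\<integral>\<^sup>+u. ennreal (killed_exp f e \<beta> u) * indicator {0..t} u \<partial>lborel) \<le> ennreal (K * (t - 0))"
    using exp_clock_increment_le[OF assms, of "max 0 s"] by (metis order_refl)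
  have "exp_clock \<beta> h s \<le> exp_clock \<beta> h (max 0 s)"
    unfolding exp_clock_def by (intro nn_integral_mono) (auto simp: indicator_def)
  also have "\<dots> \<le> ennreal (K * (max 0 s - 0))"
    unfolding exp_clock_killed_exp(1)[OF assms] by (rule K(2)) auto
  also have "\<dots> < \<infinity>" by simp
  finally show ?thesis by (simp add: real_exp_clock_def less_top)
qed

lemma real_exp_clock_nonneg: "0 \<le> real_exp_clock \<beta> s"
  by (simp add: real_exp_clock_def)

lemma exp_clock_mono: "s \<le> t \<Longrightarrow> exp_clock \<beta> h s \<le> exp_clock \<beta> h t"
  unfolding exp_clock_def by (intro nn_integral_mono) (auto simp: indicator_def)

lemma real_exp_clock_mono: "0 < \<beta> \<Longrightarrow> s \<le> t \<Longrightarrow> real_exp_clock \<beta> s \<le> real_exp_clock \<beta> t"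
  using exp_clock_mono[of s t \<beta>] by (simp add: exp_clock_eq_real real_exp_clock_nonneg)

lemma real_exp_clock_0: "0 < \<beta> \<Longrightarrow> real_exp_clock \<beta> 0 = 0"
proof -
  assume "0 < \<beta>"
  have "exp_clock \<beta> h 0 = (\<integral>\<^sup>+u. ennreal (exp_killed (ereal \<beta> * h 0)) * indicator {0::real} u \<partial>lborel)"
    unfolding exp_clock_def by (intro nn_integral_cong) (auto simp: indicator_def)
  then show ?thesis by (simp add: real_exp_clock_def nn_integral_cmult_indicator)
qed

lemma real_exp_clock_add:
  assumes "0 < \<beta>" "0 \<le> s" "s \<le> t"
  shows "(\<integral>\<^sup>+u. ennreal (killed_exp f e \<beta> u) * indicator {s<..t} u \<partial>lborel) = ennreal (real_exp_clock \<beta> t - real_exp_clock \<beta> s)"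
proof -
  let ?D = "\<integral>\<^sup>+u. ennreal (killed_exp f e \<beta> u) * indicator {s<..t} u \<partial>lborel"
  have "exp_clock \<beta> h t = (\<integral>\<^sup>+u. ennreal (killed_exp f e \<beta> u) * indicator {0..s} u +
      ennreal (killed_exp f e \<beta> u) * indicator {s<..t} u \<partial>lborel)"
    unfolding exp_clock_killed_exp(1)[OF assms(1)] using assms
    by (intro nn_integral_cong) (auto simp: indicator_def)
  also have "\<dots> = exp_clock \<beta> h s + ?D"
    unfolding exp_clock_killed_exp(1)[OF assms(1)] by (intro nn_integral_add) auto
  finally have eq: "ennreal (real_exp_clock \<beta> t) = ennreal (real_exp_clock \<beta> s) + ?D" by (simp add: exp_clock_eq_real assms)
  then obtain d where "?D = ennreal d" "0 \<le> d" by (cases ?D) auto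
  with eq show ?thesis using real_exp_clock_nonneg by (simp add: ennreal_plus[symmetric] del: ennreal_plus)
qed

lemma continuous_on_real_exp_clock:
  assumes "0 < \<beta>"
  shows "continuous_on {0..r} (real_exp_clock \<beta>)"
proof -
  obtain K where K: "0 < K"
    "\<And>s t. 0 \<le> s \<Longrightarrow> s \<le> t \<Longrightarrow> t \<le> r \<Longrightarrow>
      (\<integral>\<^sup>+u. ennreal (killed_exp f e \<beta> u) * indicator {s..t} u \<partial>lborel) \<le> ennreal (K * (t - s))"
    using exp_clock_increment_le[OF assms] by blast
  have le: "real_exp_clock \<beta> t - real_exp_clock \<beta> s \<le> K * (t - s)" if "0 \<le> s" "s \<le> t" "t \<le> r" for s t
  proof -
    have "ennreal (real_exp_clock \<beta> t - real_exp_clock \<beta> s) \<le> (\<integral>\<^sup>+u. ennreal (killed_exp f e \<beta> u) * indicator {s..t} u \<partial>lborel)"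
      unfolding real_exp_clock_add[OF assms that(1,2), symmetric]
      by (intro nn_integral_mono) (auto simp: indicator_def)
    also note K(2)[OF that]
    finally show ?thesis using K(1) that by (simp add: ennreal_le_iff)
  qed
  have "K-lipschitz_on {0..r} (real_exp_clock \<beta>)"
  proof (rule lipschitz_onI)
    fix s t assume "s \<in> {0..r}" "t \<in> {0..r}"
    then show "dist (real_exp_clock \<beta> s) (real_exp_clock \<beta> t) \<le> K * dist s t"
      using le[of s t] le[of t s] real_exp_clock_mono[OF assms, of s t] real_exp_clock_mono[OF assms, of t s]
      by (cases "s \<le> t") (auto simp: dist_real_def abs_real_def)
  qed (use K in auto)
  then show ?thesis by (rule lipschitz_on_continuous_on)
qed

text \<open>The integrand is strictly positive before the killing time, so it has positive integral
  just after \<open>s\<close>.\<close>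

lemma real_exp_clock_strict_mono:
  assumes "0 < \<beta>" "0 \<le> s" "s < t" "ereal s < e"
  shows "real_exp_clock \<beta> s < real_exp_clock \<beta> t"
proof -
  \<comment> \<open>\<open>t\<close> may lie beyond the killing time; \<open>t'\<close> is an
    earlier time at which the path is still alive.\<close>
  have "ereal s < min (ereal t) e" using assms by auto
  then obtain t' where t': "s < t'" "t' < t" "ereal t' < e"
    using ereal_dense2 by fastforce
  have "(\<integral>\<^sup>+u. ennreal (killed_exp f e \<beta> u) * indicator {s<..t'} u \<partial>lborel) \<noteq> 0"
  proof
    assume "(\<integral>\<^sup>+u. ennreal (killed_exp f e \<beta> u) * indicator {s<..t'} u \<partial>lborel) = 0"
    then have "AE u in lborel. u \<notin> {s<..t'}"
    proof (subst (asm) nn_integral_0_iff_AE, simp, elim AE_mp, intro AE_I2 impI notI)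
      fix u assume u: "u \<in> {s<..t'}" "ennreal (killed_exp f e \<beta> u) * indicator {s<..t'} u = 0"
      then have "ereal u < e" using t'(3) by (auto intro: le_less_trans[of "ereal u" "ereal t'"])
      with u assms show False by (simp add: killed_exp_def max_absorb2)
    qed
    then have "emeasure lborel {s<..t'} = 0"
      by (subst (asm) AE_iff_measurable[OF _ refl]) (auto simp: greaterThanAtMost_def greaterThan_def atMost_def Int_def)
    with t' show False by simp
  qed
  then have "ennreal (real_exp_clock \<beta> t' - real_exp_clock \<beta> s) \<noteq> 0" using real_exp_clock_add[of \<beta> s t'] assms t' by simp
  then have "real_exp_clock \<beta> s < real_exp_clock \<beta> t'" using ennreal_neg[of "real_exp_clock \<beta> t' - real_exp_clock \<beta> s"] by force
  also have "\<dots> \<le> real_exp_clock \<beta> t" using t' assms by (intro real_exp_clock_mono) auto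
  finally show ?thesis .
qed

lemma real_exp_clock_after_killing:
  assumes "0 < \<beta>" "0 \<le> s" "s \<le> t" "e \<le> ereal s"
  shows "real_exp_clock \<beta> t = real_exp_clock \<beta> s"
proof -
  have "killed_exp f e \<beta> u = 0" if "s < u" for u
  proof -
    have "e \<le> ereal (max 0 u)" using assms that by (auto intro: order_trans[of e "ereal s"])
    then show ?thesis by (simp add: killed_exp_def not_less[symmetric])
  qed
  then have "(\<integral>\<^sup>+u. ennreal (killed_exp f e \<beta> u) * indicator {s<..t} u \<partial>lborel) = (\<integral>\<^sup>+u. 0 \<partial>(lborel :: real measure))"
    by (intro nn_integral_cong) (auto simp: indicator_def)
  then have "ennreal (real_exp_clock \<beta> t - real_exp_clock \<beta> s) = 0" by (simp add: real_exp_clock_add assms)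
  then have "real_exp_clock \<beta> t - real_exp_clock \<beta> s \<le> 0" by (simp only: ennreal_eq_0_iff)
  then show ?thesis using real_exp_clock_mono[of \<beta> s t] assms by simp
qed

lemma exp_clock_total_SUP:
  assumes "0 < \<beta>"
  shows "exp_clock_total \<beta> h = (SUP n. exp_clock \<beta> h (real n))"
proof -
  let ?f = "\<lambda>u. ennreal (killed_exp f e \<beta> u)"
  have "?f s * indicator {0..} s = (SUP n. ?f s * indicator {0..real n} s)" for s
  proof (rule antisym)
    obtain n where "s \<le> real n" using real_arch_simple by blast
    then show "?f s * indicator {0..} s \<le> (SUP n. ?f s * indicator {0..real n} s)"
      by (intro SUP_upper2[of n]) (auto simp: indicator_def)
  qed (intro SUP_least mult_left_mono; auto simp: indicator_def)
  then have "exp_clock_total \<beta> h = (\<integral>\<^sup>+s. (SUP n. ?f s * indicator {0..real n} s) \<partial>lborel)"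
    unfolding exp_clock_killed_exp(2)[OF assms] by simp
  also have "\<dots> = (SUP n. \<integral>\<^sup>+s. ?f s * indicator {0..real n} s \<partial>lborel)"
    by (intro nn_integral_monotone_convergence_SUP incseq_SucI le_funI mult_left_mono)
      (auto simp: indicator_def)
  finally show ?thesis unfolding exp_clock_killed_exp(1)[OF assms] .
qed

lemma exp_clock_le_total: "exp_clock \<beta> h s \<le> exp_clock_total \<beta> h"
  unfolding exp_clock_def exp_clock_total_def by (intro nn_integral_mono) (auto simp: indicator_def)

lemma real_exp_clock_less_total:
  assumes "0 < \<beta>" "0 \<le> s" "ereal s < e"
  shows "ennreal (real_exp_clock \<beta> s) < exp_clock_total \<beta> h"
proof -
  have "ennreal (real_exp_clock \<beta> s) < ennreal (real_exp_clock \<beta> (s + 1))"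
    using real_exp_clock_strict_mono[of \<beta> s "s + 1"] assms real_exp_clock_nonneg by (simp add: ennreal_less_iff)
  also have "\<dots> \<le> exp_clock_total \<beta> h"
    using exp_clock_le_total assms by (simp flip: exp_clock_eq_real)
  finally show ?thesis .
qed

text \<open>Strict growth before killing makes the set in the infimum equal to
  \<open>{s<..}\<close>.\<close>

lemma exp_clock_inverse_real:
  assumes "0 < \<beta>" "0 \<le> s" "ereal s < e"
  shows "exp_clock_inverse \<beta> h (real_exp_clock \<beta> s) = s"
proof -
  have "{t. 0 \<le> t \<and> exp_clock \<beta> h t > ennreal (real_exp_clock \<beta> s)} = {s<..}"
  proof (intro set_eqI iffI)
    fix t assume "t \<in> {t. 0 \<le> t \<and> exp_clock \<beta> h t > ennreal (real_exp_clock \<beta> s)}"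
    then show "t \<in> {s<..}" using real_exp_clock_mono[of \<beta> t s] assms
      by (auto simp: exp_clock_eq_real ennreal_less_iff real_exp_clock_nonneg not_le[symmetric])
  next
    fix t assume "t \<in> {s<..}"
    then show "t \<in> {t. 0 \<le> t \<and> exp_clock \<beta> h t > ennreal (real_exp_clock \<beta> s)}"
      using real_exp_clock_strict_mono[of \<beta> s t] assms by (auto simp: exp_clock_eq_real ennreal_less_iff real_exp_clock_nonneg)
  qed
  then show ?thesis by (simp add: exp_clock_inverse_def)
qed

text \<open>Intermediate values of a continuous clock that starts at 0 and exceeds \<open>r\<close>
  at some integer time.\<close>

lemma real_exp_clock_surj:
  assumes "0 < \<beta>" "0 \<le> r" "ennreal r < exp_clock_total \<beta> h"
  obtains s where "0 \<le> s" "ereal s < e" "real_exp_clock \<beta> s = r"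
proof -
  obtain n where "ennreal r < exp_clock \<beta> h (real n)"
    using assms by (auto simp: exp_clock_total_SUP less_SUP_iff)
  then have n: "r < real_exp_clock \<beta> (real n)" using assms by (simp add: exp_clock_eq_real ennreal_less_iff)
  obtain s where s: "0 \<le> s" "s \<le> real n" "real_exp_clock \<beta> s = r"
    using IVT'[of "real_exp_clock \<beta>" 0 r "real n"] n assms continuous_on_real_exp_clock[OF assms(1), of "real n"]
    by (auto simp: real_exp_clock_0)
  \<comment> \<open>After killing the clock is constant, so it could not rise from \<open>r\<close>
    at \<open>s\<close> to a larger value at \<open>n\<close>.\<close>
  have "ereal s < e"
    using real_exp_clock_after_killing[of \<beta> s "real n"] s n assms by (auto simp: not_le[symmetric])
  with s show ?thesis using that by blast
qed

section \<open>Composition of the two time changes along one path\<close>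

context
  fixes X :: "real \<Rightarrow> 'w \<Rightarrow> real" and \<omega> :: 'w and x \<alpha> :: real
  assumes x: "0 < x" and \<alpha>: "1 < \<alpha>" and rc: "right_cont_path (\<lambda>t. X t \<omega>)"
    and X: "\<And>t. 0 \<le> t \<Longrightarrow> X t \<omega> = lamperti_transform \<alpha> x h t"
begin

text \<open>The time of \<open>X\<close> that corresponds to the time \<open>v\<close> of the Levy
  path: there \<open>X\<close> equals \<open>x * exp (f v)\<close> before killing.\<close>

definition lamperti_time :: "real \<Rightarrow> real" where "lamperti_time v = x powr \<alpha> * real_exp_clock \<alpha> v"

lemma lamperti_time_nonneg: "0 \<le> lamperti_time v"
  using x by (simp add: lamperti_time_def real_exp_clock_nonneg)

lemma lamperti_time_mono: "s \<le> t \<Longrightarrow> lamperti_time s \<le> lamperti_time t"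
  using x \<alpha> by (auto simp: lamperti_time_def intro!: mult_left_mono real_exp_clock_mono)

lemma lamperti_time_strict_mono: "0 \<le> s \<Longrightarrow> s < t \<Longrightarrow> ereal s < e \<Longrightarrow> lamperti_time s < lamperti_time t"
  using x \<alpha> real_exp_clock_strict_mono[of \<alpha> s t] by (simp add: lamperti_time_def)

lemma lamperti_time_surj:
  assumes "0 \<le> r" "ennreal r < ennreal (x powr \<alpha>) * exp_clock_total \<alpha> h"
  obtains s where "0 \<le> s" "ereal s < e" "lamperti_time s = r"
proof -
  have r: "r = x powr \<alpha> * (r * x powr (-\<alpha>))" using x by (simp add: powr_minus)
  have "ennreal (r * x powr (-\<alpha>)) < exp_clock_total \<alpha> h"
    using assms(2) x assms(1) by (subst (asm) r, subst (asm) ennreal_mult') (auto simp: ennreal_mult_less_cancel_pos)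
  then obtain s where "0 \<le> s" "ereal s < e" "real_exp_clock \<alpha> s = r * x powr (-\<alpha>)"
    using real_exp_clock_surj[of \<alpha> "r * x powr (-\<alpha>)"] assms x \<alpha> by auto
  then show ?thesis using r by (intro that[of s]) (auto simp: lamperti_time_def)
qed

lemma X_lamperti_time:
  assumes "0 \<le> v" "ereal v < e"
  shows "X (lamperti_time v) \<omega> = x * exp (f v)"
proof -
  have "ennreal (lamperti_time v) < ennreal (x powr \<alpha>) * exp_clock_total \<alpha> h"
    using x \<alpha> real_exp_clock_less_total[of \<alpha> v] assms real_exp_clock_nonneg
    by (simp add: lamperti_time_def ennreal_mult' ennreal_mult_less_cancel_pos)
  moreover have "lamperti_time v * x powr (-\<alpha>) = real_exp_clock \<alpha> v" using x by (simp add: lamperti_time_def powr_minus)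
  ultimately show ?thesis
    using assms \<alpha> by (simp add: X lamperti_time_nonneg lamperti_transform_def exp_clock_inverse_real h kill_at_def exp_killed_def)
qed

lemma measurable_lamperti_time [measurable]: "lamperti_time \<in> borel_measurable borel"
  by (rule borel_measurable_mono) (auto simp: mono_def intro: lamperti_time_mono)

text \<open>The clock of the Lamperti representation pushes its own density forward to Lebesgue measure;
  this replaces the substitution rule, which needs a continuous density.\<close>

lemma distr_lamperti_time:
  assumes s: "0 \<le> s" "ereal s < e"
  shows "distr (density lborel (\<lambda>v. ennreal (x powr \<alpha> * killed_exp f e \<alpha> v) * indicator {0..s} v)) borel lamperti_time =
    density lborel (indicator {0..lamperti_time s})"
    (is "?L = ?R")
proof (rule measure_eqI_lessThan)
  have L: "emeasure ?L {a<..} = (\<integral>\<^sup>+v. ennreal (x powr \<alpha>) *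
      (ennreal (killed_exp f e \<alpha> v) * (indicator {0..s} v * indicator {a<..} (lamperti_time v))) \<partial>lborel)" for a
  proof -
    have "emeasure ?L {a<..} = emeasure (density lborel (\<lambda>v. ennreal (x powr \<alpha> * killed_exp f e \<alpha> v) * indicator {0..s} v)) (lamperti_time -` {a<..})"
      by (subst emeasure_distr) auto
    also have "\<dots> = (\<integral>\<^sup>+v. ennreal (x powr \<alpha> * killed_exp f e \<alpha> v) * indicator {0..s} v * indicator (lamperti_time -` {a<..}) v \<partial>lborel)"
      using measurable_sets[OF measurable_lamperti_time, of "{a<..}"] by (subst emeasure_density) auto
    also have "\<dots> = (\<integral>\<^sup>+v. ennreal (x powr \<alpha>) *
      (ennreal (killed_exp f e \<alpha> v) * (indicator {0..s} v * indicator {a<..} (lamperti_time v))) \<partial>lborel)"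
      using killed_exp_nonneg
      by (intro nn_integral_cong) (auto simp: indicator_def ennreal_mult')
    finally show ?thesis .
  qed
  have eq: "emeasure ?L {a<..} = ennreal (x powr \<alpha>) * (\<integral>\<^sup>+v. ennreal (killed_exp f e \<alpha> v) * indicator A v \<partial>lborel)"
    if "A \<in> sets borel" "\<And>v. v \<in> A \<longleftrightarrow> v \<in> {0..s} \<and> a < lamperti_time v" for a A
  proof -
    have "(indicator {0..s} v * indicator {a<..} (lamperti_time v) :: ennreal) = indicator A v" for v
      using that(2)[of v] by (auto simp: indicator_def)
    then show ?thesis unfolding L using that(1) by (simp add: nn_integral_cmult)
  qed
  show main: "emeasure ?L {a<..} = emeasure ?R {a<..}" for a
  proof -
    have R: "emeasure ?R {a<..} = emeasure lborel ({0..lamperti_time s} \<inter> {a<..})"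
      by (subst emeasure_density) (auto simp: indicator_inter_arith[symmetric])
    \<comment> \<open>Measures are compared on half-lines. The set of \<open>v\<close> in
      \<open>{0..s}\<close> with \<open>lamperti_time v > a\<close> is all of \<open>{0..s}\<close>,
      empty, or \<open>{w<..s}\<close> where \<open>lamperti_time w = a\<close>.\<close>
    consider "a < 0" | "lamperti_time s \<le> a" | "0 \<le> a" "a < lamperti_time s" by linarith
    then show ?thesis
    proof cases
      case 1
      have "emeasure ?L {a<..} = ennreal (x powr \<alpha>) * exp_clock \<alpha> h s"
        using 1 \<alpha> lamperti_time_nonneg by (subst eq[of "{0..s}"]) (auto simp: exp_clock_killed_exp intro: less_le_trans)
      also have "\<dots> = ennreal (lamperti_time s)" using \<alpha> by (simp add: exp_clock_eq_real lamperti_time_def ennreal_mult')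
      also have "\<dots> = emeasure lborel ({0..lamperti_time s} \<inter> {a<..})"
      proof -
        have "{0..lamperti_time s} \<inter> {a<..} = {0..lamperti_time s}" using 1 by auto
        then show ?thesis using lamperti_time_nonneg by simp
      qed
      finally show ?thesis unfolding R .
    next
      case 2
      have "v \<le> s \<Longrightarrow> \<not> a < lamperti_time v" for v using 2 lamperti_time_mono[of v s] by auto
      then have "emeasure ?L {a<..} = 0" by (subst eq[of "{}"]) auto
      moreover have "{0..lamperti_time s} \<inter> {a<..} = {}" using 2 by auto
      ultimately show ?thesis unfolding R by simp
    next
      case 3
      have "continuous_on {0..s} lamperti_time" unfolding lamperti_time_def
        using \<alpha> by (intro continuous_intros continuous_on_real_exp_clock) auto
      then obtain w where w: "0 \<le> w" "w \<le> s" "lamperti_time w = a"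
        using IVT'[of lamperti_time 0 a s] 3 s \<alpha> by (auto simp: lamperti_time_def real_exp_clock_0)
      have we: "ereal w < e" using w s by (auto intro: le_less_trans[of _ "ereal s"])
      have iff: "a < lamperti_time v \<longleftrightarrow> w < v" if "0 \<le> v" for v
        using lamperti_time_strict_mono[OF w(1) _ we, of v] lamperti_time_mono[of v w] w by (auto simp: not_le[symmetric])
      have "emeasure ?L {a<..} = ennreal (x powr \<alpha>) * ennreal (real_exp_clock \<alpha> s - real_exp_clock \<alpha> w)"
        using w \<alpha> iff by (subst eq[of "{w<..s}"]) (auto simp: real_exp_clock_add)
      also have "\<dots> = ennreal (lamperti_time s - a)"
        using w by (simp add: ennreal_mult'[symmetric] lamperti_time_def[of s] right_diff_distrib) (simp add: lamperti_time_def)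
      also have "\<dots> = emeasure lborel ({0..lamperti_time s} \<inter> {a<..})"
      proof -
        have "{0..lamperti_time s} \<inter> {a<..} = {a<..lamperti_time s}" using 3 by auto
        then show ?thesis using 3 by simp
      qed
      finally show ?thesis unfolding R .
    qed
  qed
  show "emeasure ?L {a<..} < \<infinity>" for a
  proof -
    have "emeasure ?R {a<..} = emeasure lborel ({0..lamperti_time s} \<inter> {a<..})"
      by (subst emeasure_density) (auto simp: indicator_inter_arith[symmetric])
    also have "\<dots> \<le> emeasure lborel {0..lamperti_time s}" by (intro emeasure_mono) auto
    also have "\<dots> < \<infinity>" using lamperti_time_nonneg[of s] by simp
    finally show ?thesis unfolding main .
  qed
qed auto

text \<open>Lebesgue measure up to \<open>lamperti_time s\<close> is replaced by the pushforward;
  multiplying its density by 1/X = 1/(x exp(f)) lowers the exponents of \<open>x\<close> and of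
  exp(f) by one.\<close>

lemma clock_lamperti_time:
  assumes s: "0 \<le> s" "ereal s < e"
  shows "clock X (lamperti_time s) \<omega> = ennreal (x powr (\<alpha> - 1) * real_exp_clock (\<alpha> - 1) s)"
proof -
  note [measurable] = measurable_right_cont_path[OF rc]
  let ?G = "\<lambda>r. inverse (ennreal (X (max 0 r) \<omega>))"
  have "clock X (lamperti_time s) \<omega> = (\<integral>\<^sup>+r. ?G r \<partial>density lborel (indicator {0..lamperti_time s}))"
    unfolding clock_max0 by (subst nn_integral_density) (auto simp: mult.commute)
  also have "\<dots> = (\<integral>\<^sup>+v. ?G (lamperti_time v) \<partial>density lborel (\<lambda>v. ennreal (x powr \<alpha> * killed_exp f e \<alpha> v) * indicator {0..s} v))"
    unfolding distr_lamperti_time[OF s, symmetric] by (subst nn_integral_distr) auto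
  also have "\<dots> = (\<integral>\<^sup>+v. ennreal (x powr \<alpha> * killed_exp f e \<alpha> v) * indicator {0..s} v * ?G (lamperti_time v) \<partial>lborel)"
    by (subst nn_integral_density) auto
  also have "\<dots> = (\<integral>\<^sup>+v. ennreal (x powr (\<alpha> - 1)) * (ennreal (killed_exp f e (\<alpha> - 1) v) * indicator {0..s} v) \<partial>lborel)"
  proof (rule nn_integral_cong)
    fix v
    show "ennreal (x powr \<alpha> * killed_exp f e \<alpha> v) * indicator {0..s} v * ?G (lamperti_time v) =
      ennreal (x powr (\<alpha> - 1)) * (ennreal (killed_exp f e (\<alpha> - 1) v) * indicator {0..s} v)"
    proof (cases "v \<in> {0..s}")
      case True
      then have ve: "ereal v < e" using s by (auto intro: le_less_trans[of _ "ereal s"])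
      have G: "?G (lamperti_time v) = ennreal (inverse (x * exp (f v)))"
        using True ve x by (simp add: max_absorb2 lamperti_time_nonneg X_lamperti_time inverse_ennreal)
      have "x powr \<alpha> * exp (\<alpha> * f v) * inverse (x * exp (f v)) = x powr (\<alpha> - 1) * exp ((\<alpha> - 1) * f v)"
        using x by (simp add: powr_diff exp_diff left_diff_distrib field_simps)
      then show ?thesis
        using True ve x unfolding G
        by (simp add: killed_exp_def max_absorb2 ennreal_mult'[symmetric])
    qed simp
  qed
  also have "\<dots> = ennreal (x powr (\<alpha> - 1)) * exp_clock (\<alpha> - 1) h s"
    using \<alpha> by (subst nn_integral_cmult) (auto simp: exp_clock_killed_exp)
  also have "\<dots> = ennreal (x powr (\<alpha> - 1) * real_exp_clock (\<alpha> - 1) s)"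
    using \<alpha> by (simp add: exp_clock_eq_real ennreal_mult')
  finally show ?thesis .
qed

text \<open>The clock of \<open>X\<close> does not exceed the given value up to
  \<open>lamperti_time s\<close>, and exceeds it at every slightly later time, since such a time is
  \<open>lamperti_time v\<close> with v > s.\<close>

lemma clock_inverse_lamperti_time:
  assumes s: "0 \<le> s" "ereal s < e"
  shows "clock_inverse X (x powr (\<alpha> - 1) * real_exp_clock (\<alpha> - 1) s) \<omega> = ennreal (lamperti_time s)"
proof (rule antisym)
  let ?t = "x powr (\<alpha> - 1) * real_exp_clock (\<alpha> - 1) s"
  show "ennreal (lamperti_time s) \<le> clock_inverse X ?t \<omega>"
    unfolding clock_inverse_def
  proof (rule INF_greatest)
    fix r assume "r \<in> {r. 0 \<le> r \<and> ennreal ?t < clock X r \<omega>}"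
    then have "\<not> r \<le> lamperti_time s" using clock_lamperti_time[OF s] clock_mono[of r "lamperti_time s" X \<omega>] by auto
    then show "ennreal (lamperti_time s) \<le> ennreal r" by (intro ennreal_leI) auto
  qed
  \<comment> \<open>A later time before killing; capping \<open>r\<close> at
    \<open>lamperti_time s1\<close> keeps it within the lifetime of \<open>X\<close>.\<close>
  obtain s1 where s1: "s < s1" "ereal s1 < e"
    using ereal_dense2[OF s(2)] by auto
  show "clock_inverse X ?t \<omega> \<le> ennreal (lamperti_time s)"
  proof (rule ennreal_le_epsilon)
    fix \<epsilon> :: real assume \<epsilon>: "0 < \<epsilon>"
    define r where "r = min (lamperti_time s + \<epsilon>) (lamperti_time s1)"
    have r: "lamperti_time s < r" "r \<le> lamperti_time s + \<epsilon>" "r \<le> lamperti_time s1"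
      using \<epsilon> lamperti_time_strict_mono[OF s(1) s1(1) s(2)] by (auto simp: r_def)
    have r0: "0 \<le> r" using r lamperti_time_nonneg[of s] by simp
    have "ennreal r \<le> ennreal (lamperti_time s1)" using r by (intro ennreal_leI) auto
    also have "\<dots> < ennreal (x powr \<alpha>) * exp_clock_total \<alpha> h"
      using x \<alpha> real_exp_clock_less_total[of \<alpha> s1] s s1
      by (simp add: lamperti_time_def ennreal_mult' ennreal_mult_less_cancel_pos)
    finally obtain v where v: "0 \<le> v" "ereal v < e" "lamperti_time v = r" using lamperti_time_surj[OF r0] by blast
    then have "s < v" using r lamperti_time_mono[of v s] by (auto simp: not_le[symmetric])
    then have "real_exp_clock (\<alpha> - 1) s < real_exp_clock (\<alpha> - 1) v" using s \<alpha> by (intro real_exp_clock_strict_mono) auto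
    then have "ennreal ?t < clock X r \<omega>"
      using clock_lamperti_time[OF v(1,2)] v x real_exp_clock_nonneg by (simp add: ennreal_less_iff)
    then have "clock_inverse X ?t \<omega> \<le> ennreal r" using r0 by (rule clock_inverse_lower)
    also have "\<dots> \<le> ennreal (lamperti_time s + \<epsilon>)" using r by (intro ennreal_leI) auto
    also have "\<dots> = ennreal (lamperti_time s) + ennreal \<epsilon>" using \<epsilon> lamperti_time_nonneg by simp
    finally show "clock_inverse X ?t \<omega> \<le> ennreal (lamperti_time s) + ennreal \<epsilon>" .
  qed
qed

text \<open>Before the total clock of index \<alpha> - 1 is used up, \<open>t\<close> corresponds to
  a time \<open>s\<close> of the Levy path and both sides are \<open>x * exp (f s)\<close>.
  Afterwards \<theta>(t) is at least the lifetime of \<open>X\<close>, and both sides are 0.\<close>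

lemma time_changed_lamperti:
  assumes t: "0 \<le> t"
  shows "time_changed X t \<omega> = lamperti_transform (\<alpha> - 1) x h t"
proof (cases "ennreal t < ennreal (x powr (\<alpha> - 1)) * exp_clock_total (\<alpha> - 1) h")
  case True
  let ?u = "t * x powr (-(\<alpha> - 1))"
  have tu: "t = x powr (\<alpha> - 1) * ?u" using x by (simp only: powr_minus) simp
  have "ennreal t = ennreal (x powr (\<alpha> - 1)) * ennreal ?u"
    using t x by (subst tu, subst ennreal_mult') auto
  with True have "ennreal ?u < exp_clock_total (\<alpha> - 1) h"
    using x by (simp add: ennreal_mult_less_cancel_pos)
  then obtain s where s: "0 \<le> s" "ereal s < e" "real_exp_clock (\<alpha> - 1) s = ?u"
    using real_exp_clock_surj[of "\<alpha> - 1" ?u] \<alpha> t by auto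
  have "exp_clock_inverse (\<alpha> - 1) h ?u = s"
    using exp_clock_inverse_real[of "\<alpha> - 1" s] \<alpha> s by simp
  then have "lamperti_transform (\<alpha> - 1) x h t = x * exp (f s)"
    using True s unfolding lamperti_transform_def by (simp add: h kill_at_def exp_killed_def)
  moreover have "clock_inverse X t \<omega> = ennreal (lamperti_time s)"
    using clock_inverse_lamperti_time[OF s(1,2)] unfolding s(3) tu[symmetric] .
  then have "time_changed X t \<omega> = x * exp (f s)"
    using X_lamperti_time[OF s(1,2)] by (simp add: time_changed_def lamperti_time_nonneg)
  ultimately show ?thesis by simp
next
  case False
  \<comment> \<open>Within the lifetime of \<open>X\<close> its clock is bounded by the rescaled
    total clock of index \<alpha> - 1, hence by \<open>t\<close>.\<close>
  have "\<not> ennreal r < ennreal (x powr \<alpha>) * exp_clock_total \<alpha> h" if r: "0 \<le> r" "ennreal t < clock X r \<omega>" for r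
  proof
    assume "ennreal r < ennreal (x powr \<alpha>) * exp_clock_total \<alpha> h"
    then obtain s where s: "0 \<le> s" "ereal s < e" "lamperti_time s = r" using lamperti_time_surj r by blast
    have "clock X r \<omega> = ennreal (x powr (\<alpha> - 1)) * exp_clock (\<alpha> - 1) h s"
      using clock_lamperti_time[OF s(1,2)] s(3) \<alpha> by (simp add: exp_clock_eq_real ennreal_mult')
    also have "\<dots> \<le> ennreal (x powr (\<alpha> - 1)) * exp_clock_total (\<alpha> - 1) h"
      by (intro mult_left_mono exp_clock_le_total) simp
    finally show False using False r by simp
  qed
  then have "ennreal (x powr \<alpha>) * exp_clock_total \<alpha> h \<le> clock_inverse X t \<omega>"
    unfolding clock_inverse_def by (intro INF_greatest) (auto simp: not_less)
  then have "time_changed X t \<omega> = 0"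
    by (cases "clock_inverse X t \<omega>") (auto simp: time_changed_def X lamperti_transform_def not_le)
  then show ?thesis using False by (simp add: lamperti_transform_def)
qed

end

end

section \<open>Preservation of the underlying Levy process\<close>

text \<open>The clauses on the law of \<eta> mention neither \<open>X\<close> nor \<alpha> and carry
  over verbatim. The Lamperti identity is transferred path by path, on the almost sure event that
  \<eta> is a killed cadlag path and represents \<open>X\<close>.\<close>

lemma underlying_levy_process_time_changed:
  assumes "1 < \<alpha>" "pssMp \<alpha> M Q X" and \<eta>: "underlying_levy_process \<alpha> Q X \<eta>"
  shows "underlying_levy_process (\<alpha> - 1) Q (time_changed X) \<eta>"
proof -
  interpret pssMp \<alpha> M Q X by fact
  have "AE \<omega> in Q x. \<forall>t\<ge>0. time_changed X t \<omega> = lamperti_transform (\<alpha> - 1) x (\<lambda>u. \<eta> u \<omega>) t" if x: "0 < x" for x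
  proof -
    have "AE \<omega> in Q x. \<exists>f e. cadlag_path f \<and> e > 0 \<and> (\<forall>t\<ge>0. \<eta> t \<omega> = kill_at f e t)"
      "AE \<omega> in Q x. \<forall>t\<ge>0. X t \<omega> = lamperti_transform \<alpha> x (\<lambda>u. \<eta> u \<omega>) t"
      using \<eta> x by (auto simp: underlying_levy_process_def killed_levy_process_def)
    with AE_space show ?thesis
    proof eventually_elim
      case (elim \<omega>)
      then obtain f e where "cadlag_path f" "e > 0" "\<And>t. 0 \<le> t \<Longrightarrow> \<eta> t \<omega> = kill_at f e t" by auto
      moreover have "right_cont_path (\<lambda>t. X t \<omega>)" using elim right_cont x by (simp add: space_Q)
      ultimately show ?case
        using elim x assms(1) by (intro allI impI time_changed_lamperti[where f=f and e=e]) auto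
    qed
  qed
  then have lamperti: "\<forall>x>0. AE \<omega> in Q x. \<forall>t\<ge>0. time_changed X t \<omega> = lamperti_transform (\<alpha> - 1) x (\<lambda>u. \<eta> u \<omega>) t"
    by (intro allI impI)
  show ?thesis
    unfolding underlying_levy_process_def
    using \<eta>[unfolded underlying_levy_process_def, THEN conjunct1]
      \<eta>[unfolded underlying_levy_process_def, THEN conjunct2, THEN conjunct1] lamperti
    by (intro conjI)
qed

text \<open>The same process \<eta> on the same space represents both processes, so the underlying
  Levy processes agree pathwise and not only in law.\<close>

theorem proposition3:
  fixes \<alpha> :: real
    and M :: "'w measure"
    and Q :: "real \<Rightarrow> 'w measure"
    and X :: "real \<Rightarrow> 'w \<Rightarrow> real"
  assumes "\<alpha> > 1"
    and "pssMp \<alpha> M Q X"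
  shows "pssMp (\<alpha> - 1) M Q (time_changed X) \<and>
    (\<forall>\<eta>. underlying_levy_process \<alpha> Q X \<eta> \<longrightarrow>
         underlying_levy_process (\<alpha> - 1) Q (time_changed X) \<eta>)"
  using pssMp.pssMp_time_changed[OF assms(2,1)] underlying_levy_process_time_changed[OF assms] by blast

end
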